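(* Let $E\to M$ be a vector bundle with a Lie algebroid structure, $\Phi\in A^1(E^* )$ a $1$-cocycle ($\mathrm d\Phi=0$), and $\hat E=E\times\mathbb R$ over $M\times\mathbb R$ the associated extended Lie algebroid. Let $\mathbf U:\mathrm{Sec}(E\oplus E^* )\to\mathrm{Sec}(\hat E\oplus\hat E^* )$ be given by $\mathbf U(X+\xi)=X+e^t\xi$, where $X,\xi$ on the right are regarded as time-independent sections. Then for all $X,Y\in\mathrm{Sec}(E)$ and $\xi,\eta\in\mathrm{Sec}(E^* )$ the Courant bracket $[\cdot,\cdot]^\wedge_C$ of the Lie algebroid $\hat E$ satisfies $$[\mathbf U(X+\xi),\mathbf U(Y+\eta)]^\wedge_C=\mathbf U\Big([X,Y]+\mathcal L^\Phi_X\eta-\mathcal L^\Phi_Y\xi+\tfrac12\mathrm d^\Phi(i_Y\xi-i_X\eta)\Big).$$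
   Context: All objects are smooth. For a Lie algebroid with bracket $[\cdot,\cdot]$, anchor $\rho$, exterior derivative $\mathrm d$ and Lie derivative $\mathcal L_X=i_X\mathrm d+\mathrm d\,i_X$ on a vector bundle $E$, the Courant bracket on sections of $E\oplus E^*$ is $[X+\xi,Y+\eta]_C=[X,Y]+\mathcal L_X\eta-\mathcal L_Y\xi+\frac12\mathrm d(i_Y\xi-i_X\eta)$. For the $1$-cocycle $\Phi$: $\mathrm d^\Phi\mu=\mathrm d\mu+\Phi\wedge\mu$ and $\mathcal L^\Phi_X\mu=i_X\mathrm d^\Phi\mu+\mathrm d^\Phi i_X\mu$ for $X\in\mathrm{Sec}(E)$ and forms $\mu\in\mathrm{Sec}(\bigwedge E^* )$. Extended Lie algebroid: $\hat E=E\times\mathbb R$ is the pulled-back bundle over $M\times\mathbb R$, with coordinate $t$ on $\mathbb R$; its sections are time-dependent sections of $E$. Its Lie algebroid structure is the unique one for which the bracket of time-independent sections is that of $E$ and the anchor on time-independent sections is $\hat\rho(X)=\rho(X)+\langle\Phi,X\rangle\partial_t$; its exterior derivative satisfies $\mathrm dt=\Phi$. *)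

theory Defs
  imports "HOL-Analysis.Analysis"
begin

subsection \<open>Smooth maps and smooth manifolds\<close>

text \<open>
  Model spaces are finite-dimensional real inner product spaces, given as a type of class
  real_inner with a finite spanning set. The class euclidean_space is not used since it excludes
  dimension 0, and hence manifolds of dimension 0 (Lie algebras as Lie algebroids over a point)
  and bundles of rank 0.
\<close>

definition finite_dim :: "'a::real_vector itself \<Rightarrow> bool" where
  "finite_dim _ \<longleftrightarrow> (\<exists>B :: 'a set. finite B \<and> span B = UNIV)"

primrec C_k_on ::
  "nat \<Rightarrow> 'a::real_normed_vector set \<Rightarrow> ('a \<Rightarrow> 'b::real_normed_vector) \<Rightarrow> bool" where
  "C_k_on 0 S f \<longleftrightarrow> continuous_on S f"
| "C_k_on (Suc k) S f \<longleftrightarrow> (\<forall>x\<in>S. f differentiable (at x)) \<and>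
     (\<forall>v. C_k_on k S (\<lambda>x. frechet_derivative f (at x) v))"

text \<open>Only meaningful for open \<open>S\<close>.\<close>

definition smooth_on :: "'a::real_normed_vector set \<Rightarrow> ('a \<Rightarrow> 'b::real_normed_vector) \<Rightarrow> bool" where
  "smooth_on S f \<longleftrightarrow> (\<forall>k. C_k_on k S f)"

text \<open>A chart is a pair of its domain and its coordinate map (only relevant on the domain).\<close>

type_synonym ('m, 'b) atlas = "('m set \<times> ('m \<Rightarrow> 'b)) set"

definition smooth_manifold ::
  "('m::{t2_space, second_countable_topology}, 'b::real_inner) atlas \<Rightarrow> bool" where
  "smooth_manifold A \<longleftrightarrow>
     finite_dim TYPE('b) \<and>
     (\<Union>(U, \<phi>)\<in>A. U) = UNIV \<and>
     (\<forall>(U, \<phi>)\<in>A. open U \<and> open (\<phi> ` U) \<and> homeomorphism U (\<phi> ` U) \<phi> (inv_into U \<phi>)) \<and>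
     (\<forall>(U, \<phi>)\<in>A. \<forall>(V, \<psi>)\<in>A. smooth_on (\<phi> ` (U \<inter> V)) (\<lambda>z. \<psi> (inv_into U \<phi> z)))"

definition smooth_in ::
  "('m, 'b::real_normed_vector) atlas \<Rightarrow> 'm set \<Rightarrow> ('m \<Rightarrow> 'c::real_normed_vector) \<Rightarrow> bool" where
  "smooth_in A W g \<longleftrightarrow> (\<forall>(U, \<phi>)\<in>A. smooth_on (\<phi> ` (U \<inter> W)) (\<lambda>z. g (inv_into U \<phi> z)))"

abbreviation smooth_fun :: "('m, 'b::real_normed_vector) atlas \<Rightarrow> ('m \<Rightarrow> real) \<Rightarrow> bool" where
  "smooth_fun A f \<equiv> smooth_in A UNIV f"

text \<open>
  Tangent vectors at \<open>x\<close> are the derivations at \<open>x\<close> of the algebra of smooth functions, extended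
  by 0 to non-smooth functions so that each derivation has exactly one representative.
\<close>

definition tangent_space ::
  "('m, 'b::real_normed_vector) atlas \<Rightarrow> 'm \<Rightarrow> (('m \<Rightarrow> real) \<Rightarrow> real) set" where
  "tangent_space A x = {v.
     (\<forall>f. \<not> smooth_fun A f \<longrightarrow> v f = 0) \<and>
     (\<forall>f g. smooth_fun A f \<longrightarrow> smooth_fun A g \<longrightarrow> v (\<lambda>y. f y + g y) = v f + v g) \<and>
     (\<forall>c f. smooth_fun A f \<longrightarrow> v (\<lambda>y. c * f y) = c * v f) \<and>
     (\<forall>f g. smooth_fun A f \<longrightarrow> smooth_fun A g \<longrightarrow>
        v (\<lambda>y. f y * g y) = f x * v g + g x * v f)}"


subsection \<open>Vector bundles\<close>

text \<open>
  The total space is the whole type \<open>'e\<close>. A local trivialization over \<open>U\<close> is given by its second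
  component \<open>\<tau>\<close>, i.e. it is the map \<open>e \<mapsto> (proj e, \<tau> e)\<close> from the preimage of \<open>U\<close> to \<open>U \<times> 'f\<close>.
  Topology and smooth structure of the total space are those determined by the smoothly compatible
  local trivializations; they are not recorded separately.
\<close>

record ('m, 'b, 'e, 'f) vbundle =
  base :: "('m, 'b) atlas"
  proj :: "'e \<Rightarrow> 'm"
  fadd :: "'e \<Rightarrow> 'e \<Rightarrow> 'e"
  fscale :: "real \<Rightarrow> 'e \<Rightarrow> 'e"
  trivs :: "('m set \<times> ('e \<Rightarrow> 'f)) set"

definition fibre :: "('m, 'b, 'e, 'f, 'z) vbundle_scheme \<Rightarrow> 'm \<Rightarrow> 'e set" where
  "fibre E x = {e. proj E e = x}"

definition vector_bundle ::
  "('m::{t2_space, second_countable_topology}, 'b::real_inner, 'e, 'f::real_inner, 'z)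
     vbundle_scheme \<Rightarrow> bool" where
  "vector_bundle E \<longleftrightarrow>
     smooth_manifold (base E) \<and>
     finite_dim TYPE('f) \<and>
     (\<forall>x. \<forall>a\<in>fibre E x. \<forall>b\<in>fibre E x. fadd E a b \<in> fibre E x) \<and>
     (\<forall>x c. \<forall>a\<in>fibre E x. fscale E c a \<in> fibre E x) \<and>
     (\<Union>(U, \<tau>)\<in>trivs E. U) = UNIV \<and>
     (\<forall>(U, \<tau>)\<in>trivs E. open U \<and>
        (\<forall>x\<in>U. bij_betw \<tau> (fibre E x) UNIV \<and>
           (\<forall>a\<in>fibre E x. \<forall>b\<in>fibre E x. \<tau> (fadd E a b) = \<tau> a + \<tau> b) \<and>
           (\<forall>c. \<forall>a\<in>fibre E x. \<tau> (fscale E c a) = c *\<^sub>R \<tau> a))) \<and>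
     (\<forall>(U, \<tau>)\<in>trivs E. \<forall>(V, \<sigma>)\<in>trivs E. \<forall>v.
        smooth_in (base E) (U \<inter> V) (\<lambda>x. \<sigma> (inv_into (fibre E x) \<tau> v)))"

definition smooth_section ::
  "('m, 'b::real_normed_vector, 'e, 'f::real_normed_vector, 'z) vbundle_scheme \<Rightarrow>
     ('m \<Rightarrow> 'e) \<Rightarrow> bool" where
  "smooth_section E X \<longleftrightarrow>
     (\<forall>x. X x \<in> fibre E x) \<and> (\<forall>(U, \<tau>)\<in>trivs E. smooth_in (base E) U (\<lambda>x. \<tau> (X x)))"

definition sadd ::
  "('m, 'b, 'e, 'f, 'z) vbundle_scheme \<Rightarrow> ('m \<Rightarrow> 'e) \<Rightarrow> ('m \<Rightarrow> 'e) \<Rightarrow> ('m \<Rightarrow> 'e)" where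
  "sadd E X Y = (\<lambda>x. fadd E (X x) (Y x))"

definition sscale ::
  "('m, 'b, 'e, 'f, 'z) vbundle_scheme \<Rightarrow> ('m \<Rightarrow> real) \<Rightarrow> ('m \<Rightarrow> 'e) \<Rightarrow> ('m \<Rightarrow> 'e)" where
  "sscale E f X = (\<lambda>x. fscale E (f x) (X x))"

text \<open>
  A \<open>k\<close>-form (smooth section of the \<open>k\<close>-th exterior power of the dual bundle) assigns to each
  point \<open>x\<close> an alternating \<open>k\<close>-linear map on the fibre over \<open>x\<close>. Arguments are passed as a list,
  and the value is 0 on lists that have the wrong length or leave the fibre. Sections of the dual
  bundle are the 1-forms; a function \<open>f\<close> is the 0-form with value \<open>f x\<close> on the empty list.
\<close>

type_synonym ('m, 'e) form = "'m \<Rightarrow> 'e list \<Rightarrow> real"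

definition smooth_form ::
  "('m, 'b::real_normed_vector, 'e, 'f::real_normed_vector, 'z) vbundle_scheme \<Rightarrow> nat \<Rightarrow>
     ('m, 'e) form \<Rightarrow> bool" where
  "smooth_form E k \<omega> \<longleftrightarrow>
     (\<forall>x es. \<not> (length es = k \<and> set es \<subseteq> fibre E x) \<longrightarrow> \<omega> x es = 0) \<and>
     (\<forall>x es i. length es = k \<longrightarrow> set es \<subseteq> fibre E x \<longrightarrow> i < k \<longrightarrow>
        (\<forall>a\<in>fibre E x. \<forall>b\<in>fibre E x.
           \<omega> x (es[i := fadd E a b]) = \<omega> x (es[i := a]) + \<omega> x (es[i := b])) \<and>
        (\<forall>c. \<forall>a\<in>fibre E x. \<omega> x (es[i := fscale E c a]) = c * \<omega> x (es[i := a]))) \<and>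
     (\<forall>x es. \<not> distinct es \<longrightarrow> \<omega> x es = 0) \<and>
     (\<forall>(U, \<tau>)\<in>trivs E. \<forall>vs. length vs = k \<longrightarrow>
        smooth_in (base E) U (\<lambda>x. \<omega> x (map (inv_into (fibre E x) \<tau>) vs)))"

definition contraction :: "('m \<Rightarrow> 'e) \<Rightarrow> ('m, 'e) form \<Rightarrow> ('m, 'e) form" where
  "contraction X \<omega> = (\<lambda>x es. \<omega> x (X x # es))"

text \<open>Exterior product of a 1-form with a form of arbitrary degree.\<close>

definition wedge1 :: "('m, 'e) form \<Rightarrow> ('m, 'e) form \<Rightarrow> ('m, 'e) form" where
  "wedge1 \<Phi> \<omega> = (\<lambda>x es. \<Sum>i<length es. (-1) ^ i * \<Phi> x [es ! i] * \<omega> x (nths es (- {i})))"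


subsection \<open>Lie algebroids and their exterior calculus\<close>

record ('m, 'b, 'e, 'f) algebroid = "('m, 'b, 'e, 'f) vbundle" +
  anchor :: "'e \<Rightarrow> (('m \<Rightarrow> real) \<Rightarrow> real)"
  bracket :: "('m \<Rightarrow> 'e) \<Rightarrow> ('m \<Rightarrow> 'e) \<Rightarrow> ('m \<Rightarrow> 'e)"

text \<open>
  The anchor is a morphism of vector bundles from \<open>E\<close> to the tangent bundle over the identity;
  its smoothness is expressed by the fact that it maps smooth sections to smooth vector fields,
  a vector field being smooth iff it maps smooth functions to smooth functions.
\<close>

definition lie_algebroid ::
  "('m::{t2_space, second_countable_topology}, 'b::real_inner, 'e, 'f::real_inner) algebroid \<Rightarrow>
     bool" where
  "lie_algebroid L \<longleftrightarrow>
     vector_bundle L \<and>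
     (\<forall>x. \<forall>a\<in>fibre L x. anchor L a \<in> tangent_space (base L) x) \<and>
     (\<forall>x. \<forall>a\<in>fibre L x. \<forall>b\<in>fibre L x. \<forall>f.
        anchor L (fadd L a b) f = anchor L a f + anchor L b f) \<and>
     (\<forall>x c. \<forall>a\<in>fibre L x. \<forall>f. anchor L (fscale L c a) f = c * anchor L a f) \<and>
     (\<forall>X f. smooth_section L X \<longrightarrow> smooth_fun (base L) f \<longrightarrow>
        smooth_fun (base L) (\<lambda>x. anchor L (X x) f)) \<and>
     (\<forall>X Y. smooth_section L X \<longrightarrow> smooth_section L Y \<longrightarrow> smooth_section L (bracket L X Y)) \<and>
     (\<forall>X Y Z. smooth_section L X \<longrightarrow> smooth_section L Y \<longrightarrow> smooth_section L Z \<longrightarrow>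
        bracket L X (sadd L Y Z) = sadd L (bracket L X Y) (bracket L X Z)) \<and>
     (\<forall>X Y. smooth_section L X \<longrightarrow> smooth_section L Y \<longrightarrow>
        bracket L X Y = sscale L (\<lambda>_. - 1) (bracket L Y X)) \<and>
     (\<forall>X Y Z. smooth_section L X \<longrightarrow> smooth_section L Y \<longrightarrow> smooth_section L Z \<longrightarrow>
        bracket L X (bracket L Y Z) =
          sadd L (bracket L (bracket L X Y) Z) (bracket L Y (bracket L X Z))) \<and>
     (\<forall>X Y f. smooth_section L X \<longrightarrow> smooth_section L Y \<longrightarrow> smooth_fun (base L) f \<longrightarrow>
        bracket L X (sscale L f Y) =
          sadd L (sscale L f (bracket L X Y)) (sscale L (\<lambda>x. anchor L (X x) f) Y)) \<and>
     (\<forall>X Y f x. smooth_section L X \<longrightarrow> smooth_section L Y \<longrightarrow> smooth_fun (base L) f \<longrightarrow>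
        anchor L (bracket L X Y x) f =
          anchor L (X x) (\<lambda>y. anchor L (Y y) f) - anchor L (Y x) (\<lambda>y. anchor L (X y) f))"

definition koszul ::
  "('m, 'b, 'e, 'f) algebroid \<Rightarrow> ('m, 'e) form \<Rightarrow> ('m \<Rightarrow> 'e) list \<Rightarrow> 'm \<Rightarrow> real" where
  "koszul L \<omega> Xs x =
     (\<Sum>i<length Xs. (-1) ^ i *
        anchor L ((Xs ! i) x) (\<lambda>y. \<omega> y (map (\<lambda>X. X y) (nths Xs (- {i}))))) +
     (\<Sum>j<length Xs. \<Sum>i<j. (-1) ^ (i + j) *
        \<omega> x (bracket L (Xs ! i) (Xs ! j) x # map (\<lambda>X. X x) (nths Xs (- {i, j}))))"

text \<open>
  The value of the exterior derivative on elements \<open>es\<close> of the fibre over \<open>x\<close> is the common value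
  of the Koszul formula at \<open>x\<close> for all smooth sections that pass through \<open>es\<close>.
\<close>

definition ext_d ::
  "('m, 'b::real_normed_vector, 'e, 'f::real_normed_vector) algebroid \<Rightarrow>
     ('m, 'e) form \<Rightarrow> ('m, 'e) form" where
  "ext_d L \<omega> = (\<lambda>x es.
     if set es \<subseteq> fibre L x
     then (THE r. \<forall>Xs. (\<forall>X\<in>set Xs. smooth_section L X) \<longrightarrow> map (\<lambda>X. X x) Xs = es \<longrightarrow>
             koszul L \<omega> Xs x = r)
     else 0)"

definition lie_derivative ::
  "('m, 'b::real_normed_vector, 'e, 'f::real_normed_vector) algebroid \<Rightarrow>
     ('m \<Rightarrow> 'e) \<Rightarrow> ('m, 'e) form \<Rightarrow> ('m, 'e) form" where
  "lie_derivative L X \<omega> = (\<lambda>x es.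
     contraction X (ext_d L \<omega>) x es + ext_d L (contraction X \<omega>) x es)"

definition ext_d_tw ::
  "('m, 'b::real_normed_vector, 'e, 'f::real_normed_vector) algebroid \<Rightarrow>
     ('m, 'e) form \<Rightarrow> ('m, 'e) form \<Rightarrow> ('m, 'e) form" where
  "ext_d_tw L \<Phi> \<omega> = (\<lambda>x es. ext_d L \<omega> x es + wedge1 \<Phi> \<omega> x es)"

definition lie_derivative_tw ::
  "('m, 'b::real_normed_vector, 'e, 'f::real_normed_vector) algebroid \<Rightarrow>
     ('m, 'e) form \<Rightarrow> ('m \<Rightarrow> 'e) \<Rightarrow> ('m, 'e) form \<Rightarrow> ('m, 'e) form" where
  "lie_derivative_tw L \<Phi> X \<omega> = (\<lambda>x es.
     contraction X (ext_d_tw L \<Phi> \<omega>) x es + ext_d_tw L \<Phi> (contraction X \<omega>) x es)"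

text \<open>The section \<open>X + \<xi>\<close> of the direct sum of \<open>E\<close> and its dual is the pair \<open>(X, \<xi>)\<close>.\<close>

fun courant_bracket ::
  "('m, 'b::real_normed_vector, 'e, 'f::real_normed_vector) algebroid \<Rightarrow>
     ('m \<Rightarrow> 'e) \<times> ('m, 'e) form \<Rightarrow> ('m \<Rightarrow> 'e) \<times> ('m, 'e) form \<Rightarrow>
     ('m \<Rightarrow> 'e) \<times> ('m, 'e) form" where
  "courant_bracket L (X, \<xi>) (Y, \<eta>) =
     (bracket L X Y,
      \<lambda>x es. lie_derivative L X \<eta> x es - lie_derivative L Y \<xi> x es +
        1 / 2 * ext_d L (\<lambda>y as. contraction Y \<xi> y as - contraction X \<eta> y as) x es)"


subsection \<open>The extended Lie algebroid\<close>

definition product_atlas :: "('m, 'b) atlas \<Rightarrow> ('m \<times> real, 'b \<times> real) atlas" where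
  "product_atlas A = (\<lambda>(U, \<phi>). (U \<times> UNIV, \<lambda>(x, t). (\<phi> x, t))) ` A"

definition pullback_bundle ::
  "('m, 'b, 'e, 'f, 'z) vbundle_scheme \<Rightarrow> ('m \<times> real, 'b \<times> real, 'e \<times> real, 'f) vbundle" where
  "pullback_bundle E =
     \<lparr> base = product_atlas (base E),
       proj = (\<lambda>(e, t). (proj E e, t)),
       fadd = (\<lambda>(a, t) (b, s). (fadd E a b, t)),
       fscale = (\<lambda>c (a, t). (fscale E c a, t)),
       trivs = (\<lambda>(U, \<tau>). (U \<times> UNIV, \<lambda>(e, t). \<tau> e)) ` trivs E \<rparr>"

text \<open>Sections and forms of \<open>E\<close>, regarded as time-independent ones of the pulled-back bundle.\<close>

definition lift_section :: "('m \<Rightarrow> 'e) \<Rightarrow> ('m \<times> real \<Rightarrow> 'e \<times> real)" where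
  "lift_section X = (\<lambda>(x, t). (X x, t))"

definition lift_form :: "('m, 'e) form \<Rightarrow> ('m \<times> real, 'e \<times> real) form" where
  "lift_form \<omega> = (\<lambda>(x, t) es. if \<forall>e\<in>set es. snd e = t then \<omega> x (map fst es) else 0)"

text \<open>
  The Lie algebroid \<open>Lh\<close> is the extension of \<open>L\<close> by \<open>\<Phi>\<close>: it lives on the pulled-back bundle, and
  on time-independent sections its bracket is that of \<open>L\<close> and its anchor is
  \<open>\<rho>(X) + \<langle>\<Phi>, X\<rangle> \<partial>\<^sub>t\<close>, here evaluated on a smooth function \<open>f\<close> at a point \<open>(x, t)\<close>.
\<close>

definition extended_lie_algebroid ::
  "('m::{t2_space, second_countable_topology}, 'b::real_inner, 'e, 'f::real_inner) algebroid \<Rightarrow>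
     ('m, 'e) form \<Rightarrow> ('m \<times> real, 'b \<times> real, 'e \<times> real, 'f) algebroid \<Rightarrow> bool" where
  "extended_lie_algebroid L \<Phi> Lh \<longleftrightarrow>
     lie_algebroid Lh \<and>
     vbundle.truncate Lh = pullback_bundle L \<and>
     (\<forall>X Y. smooth_section L X \<longrightarrow> smooth_section L Y \<longrightarrow>
        bracket Lh (lift_section X) (lift_section Y) = lift_section (bracket L X Y)) \<and>
     (\<forall>X f x t. smooth_section L X \<longrightarrow> smooth_fun (base Lh) f \<longrightarrow>
        anchor Lh (lift_section X (x, t)) f =
          anchor L (X x) (\<lambda>y. f (y, t)) + \<Phi> x [X x] * deriv (\<lambda>s. f (x, s)) t)"

fun U_map ::
  "('m \<Rightarrow> 'e) \<times> ('m, 'e) form \<Rightarrow>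
     ('m \<times> real \<Rightarrow> 'e \<times> real) \<times> ('m \<times> real, 'e \<times> real) form" where
  "U_map (X, \<xi>) = (lift_section X, \<lambda>(x, t) es. exp t * lift_form \<xi> (x, t) es)"

end

theory Submission
  imports Defs
begin

text \<open>
  Since \<open>dt = \<Phi>\<close> in the extended Lie algebroid, \<open>d(e\<^sup>t \<omega>) = e\<^sup>t d\<^sup>\<Phi> \<omega>\<close> for every time-independent
  form \<open>\<omega>\<close>. Contraction with a time-independent section commutes with multiplication by \<open>e\<^sup>t\<close>, so
  by Cartan's formula the same intertwining holds for the Lie derivatives, hence term by term for
  the Courant bracket. The identity for \<open>d\<close> follows by evaluating the Koszul formula on
  time-independent sections. This is legitimate because the Koszul formula is linear over smooth
  functions, so that bump functions and local frames show it to depend only on the values of the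
  sections at the point, and because every element of a fibre is the value of a smooth section.
\<close>

section \<open>Calculus of smooth maps\<close>

text \<open>The data are global: the bracket takes sections over all of M, and a tangent vector is a
  derivation of the algebra of globally smooth functions, so neither can simply be restricted to an
  open set. Locality has to be extracted by cutting off. Given p, a section X is written as
  \<open>(1 - \<beta> * \<beta>) X\<close> plus a finite sum of terms \<open>f v\<close> times a
  frame section, with a bump function \<beta> that is 1 at p. One factor \<beta> makes the
  coordinate function global, the other the frame section. Model spaces may have dimension 0 and are
  only inner product spaces with a finite spanning set. Coordinates therefore come from an
  orthogonal spanning set, which may contain 0, and the compactness of balls behind the bump
  functions is deduced from these coordinates. The Courant bracket applies d only to 1-forms and to
  functions, so the Koszul formula is analysed for degrees k \<le> 1. Forms are nevertheless
  functions on all lists, and an equality of forms also has to match their default values on lists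
  of the wrong length or outside the fibre.\<close>

lemma has_derivative_cong_open:
  assumes "open S" "x \<in> S" "\<And>y. y \<in> S \<Longrightarrow> f y = g y"
  shows "(f has_derivative D) (at x) \<longleftrightarrow> (g has_derivative D) (at x)"
  using has_derivative_transform_within_open[of f D x UNIV S g]
    has_derivative_transform_within_open[of g D x UNIV S f] assms by auto

lemma C_k_on_cong:
  assumes "open S" "\<And>x. x \<in> S \<Longrightarrow> f x = g x"
  shows "C_k_on k S f \<longleftrightarrow> C_k_on k S g"
  using assms(2)
proof (induction k arbitrary: f g)
  case 0
  then show ?case by (simp cong: continuous_on_cong)
next
  case (Suc k)
  have D: "(f has_derivative D) (at x) \<longleftrightarrow> (g has_derivative D) (at x)" if "x \<in> S" for x D
    using has_derivative_cong_open[OF assms(1) that Suc.prems] .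
  have "C_k_on k S (\<lambda>x. frechet_derivative f (at x) v) \<longleftrightarrow>
      C_k_on k S (\<lambda>x. frechet_derivative g (at x) v)" for v
    by (rule Suc.IH) (simp add: frechet_derivative_def D)
  then show ?case
    using D by (auto simp: differentiable_def)
qed

lemma C_k_on_subset: "C_k_on k S f \<Longrightarrow> T \<subseteq> S \<Longrightarrow> C_k_on k T f"
  by (induction k arbitrary: f) (auto intro: continuous_on_subset)

lemma C_k_on_local:
  assumes "\<And>x. x \<in> S \<Longrightarrow> \<exists>T. open T \<and> x \<in> T \<and> C_k_on k T f"
  shows "C_k_on k S f"
  using assms
proof (induction k arbitrary: f)
  case 0
  then show ?case
    by (metis C_k_on.simps(1) continuous_at_imp_continuous_on continuous_on_eq_continuous_at)
next
  case (Suc k)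
  have "C_k_on k S (\<lambda>x. frechet_derivative f (at x) v)" for v
    by (rule Suc.IH) (use Suc.prems in fastforce)
  then show ?case
    using Suc.prems by fastforce
qed

text \<open>Accepts any explicit formula for the derivative in place of
  \<open>frechet_derivative\<close>; on an open set the two agree, and \<open>C_k_on\<close> does
  not see the difference. The inductions on the order all run through this rule.\<close>

lemma C_k_on_SucI:
  assumes "open S" "\<And>x. x \<in> S \<Longrightarrow> (f has_derivative f' x) (at x)"
    and "\<And>v. C_k_on k S (\<lambda>x. f' x v)"
  shows "C_k_on (Suc k) S f"
proof -
  have "C_k_on k S (\<lambda>x. frechet_derivative f (at x) v)" for v
    using C_k_on_cong[OF assms(1), of "\<lambda>x. frechet_derivative f (at x) v" "\<lambda>x. f' x v"]
      frechet_derivative_at[OF assms(2)] assms(3) by metis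
  then show ?thesis
    using assms(2) by (auto simp: differentiable_def)
qed

lemma C_k_on_SucD:
  assumes "C_k_on (Suc k) S f"
  shows "x \<in> S \<Longrightarrow> (f has_derivative frechet_derivative f (at x)) (at x)"
    and "C_k_on k S (\<lambda>x. frechet_derivative f (at x) v)"
  using assms by (auto simp: frechet_derivative_works)

lemma C_k_on_Suc_imp: "C_k_on (Suc k) S f \<Longrightarrow> C_k_on k S f"
proof (induction k arbitrary: f)
  case 0
  then show ?case
    by (auto intro!: continuous_at_imp_continuous_on differentiable_imp_continuous_within)
next
  case (Suc k)
  then show ?case
    by (metis C_k_on.simps(2))
qed

lemma C_k_on_const: "open S \<Longrightarrow> C_k_on k S (\<lambda>x. c)"
proof (induction k arbitrary: c)
  case (Suc k)
  show ?case
    by (rule C_k_on_SucI[where f' = "\<lambda>_ _. 0"]) (use Suc in \<open>auto intro!: derivative_eq_intros\<close>)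
qed simp

lemma C_k_on_linear:
  assumes "open S" "bounded_linear f"
  shows "C_k_on k S f"
proof (cases k)
  case 0
  then show ?thesis
    using assms(2) by (simp add: linear_continuous_on)
next
  case (Suc l)
  show ?thesis unfolding Suc
    by (rule C_k_on_SucI[where f' = "\<lambda>_. f"])
      (use assms in \<open>auto intro: bounded_linear_imp_has_derivative C_k_on_const\<close>)
qed

lemma C_k_on_add:
  assumes "open S" "C_k_on k S f" "C_k_on k S g"
  shows "C_k_on k S (\<lambda>x. f x + g x)"
  using assms(2,3)
proof (induction k arbitrary: f g)
  case (Suc k)
  show ?case
  proof (rule C_k_on_SucI[OF assms(1)])
    show "((\<lambda>x. f x + g x) has_derivative
        (\<lambda>v. frechet_derivative f (at x) v + frechet_derivative g (at x) v)) (at x)"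
      if "x \<in> S" for x
      by (intro has_derivative_add Suc.prems[THEN C_k_on_SucD(1)] that)
    show "C_k_on k S (\<lambda>x. frechet_derivative f (at x) v + frechet_derivative g (at x) v)" for v
      by (intro Suc.IH C_k_on_SucD(2) Suc.prems)
  qed
qed (auto intro: continuous_intros)

text \<open>The Leibniz rule yields two products of the same kind, with one factor differentiated
  and the other of order lowered by one. Hence the induction has to vary both factors.\<close>

lemma C_k_on_bilinear:
  assumes "bounded_bilinear p" "open S" "C_k_on k S f" "C_k_on k S g"
  shows "C_k_on k S (\<lambda>x. p (f x) (g x))"
  using assms(3,4)
proof (induction k arbitrary: f g)
  case 0
  then show ?case
    by (simp add: bounded_bilinear.continuous_on[OF assms(1)])
next
  case (Suc k)
  show ?case
  proof (rule C_k_on_SucI[OF assms(2)])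
    show "((\<lambda>x. p (f x) (g x)) has_derivative
        (\<lambda>v. p (f x) (frechet_derivative g (at x) v) + p (frechet_derivative f (at x) v) (g x))) (at x)"
      if "x \<in> S" for x
      by (intro bounded_bilinear.FDERIV[OF assms(1)] Suc.prems[THEN C_k_on_SucD(1)] that)
    show "C_k_on k S (\<lambda>x. p (f x) (frechet_derivative g (at x) v) +
        p (frechet_derivative f (at x) v) (g x))" for v
      by (intro C_k_on_add assms(2) Suc.IH Suc.prems[THEN C_k_on_SucD(2)]
          Suc.prems[THEN C_k_on_Suc_imp])
  qed
qed

text \<open>For a real outer function the derivative is multiplication by its value in direction 1.
  This splits off the direction \<open>frechet_derivative g (at x) v\<close>, which varies with x,
  so that only derivatives in fixed directions remain, as \<open>C_k_on\<close> requires.\<close>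

lemma C_k_on_compose_real:
  fixes h :: "real \<Rightarrow> real"
  assumes "open S" "C_k_on k UNIV h" "C_k_on k S g"
  shows "C_k_on k S (\<lambda>x. h (g x))"
  using assms(2,3)
proof (induction k arbitrary: g h)
  case 0
  then show ?case
    using continuous_on_compose2[of UNIV h S g] by simp
next
  case (Suc k)
  show ?case
  proof (rule C_k_on_SucI[OF assms(1)])
    fix x assume "x \<in> S"
    have h: "(h has_derivative (\<lambda>v. frechet_derivative h (at (g x)) 1 * v)) (at (g x))"
    proof -
      have D: "(h has_derivative frechet_derivative h (at (g x))) (at (g x))"
        using C_k_on_SucD(1)[OF Suc.prems(1)] by simp
      then interpret linear "frechet_derivative h (at (g x))"
        by (rule has_derivative_linear)
      have "frechet_derivative h (at (g x)) v = frechet_derivative h (at (g x)) 1 * v" for v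
        using scaleR[of v 1] by (simp add: mult.commute)
      then show ?thesis
        by (intro has_derivative_eq_rhs[OF D] ext)
    qed
    show "((\<lambda>x. h (g x)) has_derivative
        (\<lambda>v. frechet_derivative h (at (g x)) 1 * frechet_derivative g (at x) v)) (at x)"
      using has_derivative_compose[OF C_k_on_SucD(1)[OF Suc.prems(2) \<open>x \<in> S\<close>] h] .
  next
    show "C_k_on k S (\<lambda>x. frechet_derivative h (at (g x)) 1 * frechet_derivative g (at x) v)" for v
      by (intro C_k_on_bilinear[OF bounded_bilinear_mult] assms(1) C_k_on_SucD(2)[OF Suc.prems(2)]
          Suc.IH[OF C_k_on_SucD(2)[OF Suc.prems(1)]] C_k_on_Suc_imp[OF Suc.prems(2)])
  qed
qed

lemma C_k_on_fst:
  assumes "open S" "C_k_on k S f"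
  shows "C_k_on k (S \<times> UNIV) (\<lambda>z. f (fst z))"
  using assms(2)
proof (induction k arbitrary: f)
  case 0
  then show ?case
    using continuous_on_compose2[OF _ continuous_on_fst[OF continuous_on_id], of S f "S \<times> UNIV"]
    by auto
next
  case (Suc k)
  show ?case
  proof (rule C_k_on_SucI)
    fix z :: "'a \<times> 'c" assume "z \<in> S \<times> UNIV"
    then have "fst z \<in> S" by auto
    from C_k_on_SucD(1)[OF Suc.prems this]
    show "((\<lambda>z. f (fst z)) has_derivative (\<lambda>v. frechet_derivative f (at (fst z)) (fst v))) (at z)"
      by (rule has_derivative_compose[rotated]) (auto intro!: derivative_eq_intros)
  qed (use assms(1) Suc.IH[OF C_k_on_SucD(2)[OF Suc.prems]] in \<open>auto intro: open_Times\<close>)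
qed

text \<open>A family closed under differentiation up to constant coefficients is smooth: each order
  is settled for all members at once. The recursion is shaped to cover both \<open>exp\<close> (a
  constant family) and \<open>flat_exp\<close>.\<close>

lemma C_k_on_iterated_deriv:
  fixes F :: "nat \<Rightarrow> real \<Rightarrow> real"
  assumes "\<And>n x. (F n has_real_derivative a n * F (n + 1) x + b n * F (n + 2) x) (at x)"
  shows "C_k_on k UNIV (F n)"
proof (induction k arbitrary: n)
  case 0
  show ?case
    using assms by (auto intro!: continuous_at_imp_continuous_on DERIV_isCont)
next
  case (Suc k)
  show ?case
  proof (rule C_k_on_SucI[OF open_UNIV])
    show "(F n has_derivative (\<lambda>v. (a n * F (n + 1) x + b n * F (n + 2) x) * v)) (at x)" for x
      using assms[of n x] by (simp add: has_field_derivative_def)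
    show "C_k_on k UNIV (\<lambda>x. (a n * F (n + 1) x + b n * F (n + 2) x) * v)" for v
      by (intro C_k_on_bilinear[OF bounded_bilinear_mult] C_k_on_add C_k_on_const open_UNIV Suc.IH)
  qed
qed

section \<open>The flat function exp(-1/x) and its derivatives\<close>

lemma inverse_power_exp_tendsto_0:
  "((\<lambda>x::real. inverse x ^ n * exp (- inverse x)) \<longlongrightarrow> 0) (at_right 0)"
proof -
  have "((\<lambda>y::real. y ^ n / exp y) \<longlongrightarrow> 0) at_top"
    by (rule tendsto_power_div_exp_0)
  from filterlim_compose[OF this filterlim_inverse_at_top_right]
  show ?thesis
    by (simp add: exp_minus divide_inverse)
qed

text \<open>Only index 0 is used for bump functions. The negative powers are included because
  differentiating produces them, and with them the family satisfies a two-term recursion.\<close>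

definition flat_exp :: "nat \<Rightarrow> real \<Rightarrow> real" where
  "flat_exp n x = (if 0 < x then inverse x ^ n * exp (- inverse x) else 0)"

lemma flat_exp_tendsto_0: "(flat_exp n \<longlongrightarrow> 0) (at 0)"
proof -
  have "(flat_exp n \<longlongrightarrow> 0) (at_right 0)"
    by (rule Lim_transform_eventually[OF inverse_power_exp_tendsto_0[of n]])
      (auto simp: flat_exp_def eventually_at_right_less eventually_at_filter)
  moreover have "(flat_exp n \<longlongrightarrow> 0) (at_left 0)"
    by (rule Lim_transform_eventually[OF tendsto_const])
      (auto simp: flat_exp_def eventually_at_filter)
  ultimately show ?thesis
    by (simp add: filterlim_split_at)
qed

lemma flat_exp_has_derivative:
  "(flat_exp n has_real_derivative - real n * flat_exp (n + 1) x + 1 * flat_exp (n + 2) x) (at x)"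
proof -
  consider "x > 0" | "x < 0" | "x = 0" by linarith
  then show ?thesis
  proof cases
    case 1
    have x: "x \<noteq> 0" using 1 by simp
    have "((\<lambda>x. inverse x ^ n) has_real_derivative - real n * inverse x ^ (n + 1)) (at x)"
      by (rule DERIV_cong[OF DERIV_power[OF DERIV_inverse[OF x]]]) (cases n; simp add: algebra_simps)
    moreover have "((\<lambda>x. exp (- inverse x)) has_real_derivative
        exp (- inverse x) * inverse x ^ 2) (at x)"
      using 1 by (auto intro!: derivative_eq_intros simp: power2_eq_square)
    ultimately have "((\<lambda>x. inverse x ^ n * exp (- inverse x)) has_real_derivative
        - real n * flat_exp (n + 1) x + 1 * flat_exp (n + 2) x) (at x)"
      by (rule DERIV_cong[OF DERIV_mult]) (use 1 in \<open>simp add: flat_exp_def power2_eq_square\<close>)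
    then show ?thesis
      by (rule has_field_derivative_transform_within_open[of _ _ _ "{0<..}"])
        (use 1 in \<open>auto simp: flat_exp_def\<close>)
  next
    case 2
    have "((\<lambda>x. 0) has_real_derivative
        - real n * flat_exp (n + 1) x + 1 * flat_exp (n + 2) x) (at x)"
      using 2 by (auto simp: flat_exp_def)
    then show ?thesis
      by (rule has_field_derivative_transform_within_open[of _ _ _ "{..<0}"])
        (use 2 in \<open>auto simp: flat_exp_def\<close>)
  next
    case 3
    \<comment> \<open>Away from 0 the difference quotient is again a member of the family,
      \<open>flat_exp (n + 1)\<close>, whose limit at 0 is already known.\<close>
    have "((\<lambda>y. (flat_exp n y - flat_exp n 0) / (y - 0)) \<longlongrightarrow> 0) (at 0)"
      by (rule Lim_transform_eventually[OF flat_exp_tendsto_0[of "n + 1"]])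
        (auto simp: flat_exp_def eventually_at_filter field_simps)
    then show ?thesis
      using 3 by (simp add: has_field_derivative_iff flat_exp_def)
  qed
qed

section \<open>Closure properties of smooth maps\<close>

lemma smooth_on_cong:
  "open S \<Longrightarrow> (\<And>x. x \<in> S \<Longrightarrow> f x = g x) \<Longrightarrow> smooth_on S f \<longleftrightarrow> smooth_on S g"
  unfolding smooth_on_def using C_k_on_cong by metis

lemma smooth_on_subset: "smooth_on S f \<Longrightarrow> T \<subseteq> S \<Longrightarrow> smooth_on T f"
  unfolding smooth_on_def using C_k_on_subset by metis

lemma smooth_on_local:
  "(\<And>x. x \<in> S \<Longrightarrow> \<exists>T. open T \<and> x \<in> T \<and> smooth_on T f) \<Longrightarrow> smooth_on S f"
  unfolding smooth_on_def by (metis C_k_on_local)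

lemma smooth_on_const: "open S \<Longrightarrow> smooth_on S (\<lambda>x. c)"
  by (simp add: smooth_on_def C_k_on_const)

lemma smooth_on_add:
  "open S \<Longrightarrow> smooth_on S f \<Longrightarrow> smooth_on S g \<Longrightarrow> smooth_on S (\<lambda>x. f x + g x)"
  by (simp add: smooth_on_def C_k_on_add)

lemma smooth_on_bilinear:
  "bounded_bilinear p \<Longrightarrow> open S \<Longrightarrow> smooth_on S f \<Longrightarrow> smooth_on S g \<Longrightarrow>
    smooth_on S (\<lambda>x. p (f x) (g x))"
  by (simp add: smooth_on_def C_k_on_bilinear)

lemma smooth_on_compose_real:
  fixes h :: "real \<Rightarrow> real"
  shows "open S \<Longrightarrow> smooth_on UNIV h \<Longrightarrow> smooth_on S g \<Longrightarrow> smooth_on S (\<lambda>x. h (g x))"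
  by (simp add: smooth_on_def C_k_on_compose_real)

lemma smooth_on_fst: "open S \<Longrightarrow> smooth_on S f \<Longrightarrow> smooth_on (S \<times> UNIV) (\<lambda>z. f (fst z))"
  by (simp add: smooth_on_def C_k_on_fst)

lemma smooth_on_exp: "smooth_on UNIV (exp :: real \<Rightarrow> real)"
  unfolding smooth_on_def
  by (intro allI C_k_on_iterated_deriv[of "\<lambda>_. exp" "\<lambda>_. 1" "\<lambda>_. 0"])
    (auto intro!: derivative_eq_intros)

lemma smooth_on_flat_exp: "smooth_on UNIV (flat_exp n)"
  unfolding smooth_on_def
  by (intro allI C_k_on_iterated_deriv[of flat_exp "\<lambda>n. - real n" "\<lambda>_. 1"] flat_exp_has_derivative)


section \<open>Finite-dimensional inner product spaces\<close>

lemma finite_dim_orthogonal_basis: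
  assumes "finite_dim TYPE('a::real_inner)"
  obtains C :: "'a::real_inner set" where "finite C"
    "\<And>u. u = (\<Sum>v\<in>C. (u \<bullet> v / (v \<bullet> v)) *\<^sub>R v)"
proof -
  obtain B :: "'a set" where "finite B" "span B = UNIV"
    using assms by (auto simp: finite_dim_def)
  then obtain C :: "'a set" where C: "finite C" "span C = UNIV" "pairwise orthogonal C"
    using basis_orthogonal[of B] by auto
  have "u = (\<Sum>v\<in>C. (u \<bullet> v / (v \<bullet> v)) *\<^sub>R v)" for u
  proof -
    have "u \<in> span C" using C by simp
    then obtain c where u: "u = (\<Sum>w\<in>C. c w *\<^sub>R w)"
      using span_finite[OF C(1)] by auto
    have "u \<bullet> v = c v * (v \<bullet> v)" if "v \<in> C" for v
    proof -
      have "u \<bullet> v = (\<Sum>w\<in>C. c w * (w \<bullet> v))"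
        by (simp add: u inner_sum_left)
      also have "\<dots> = (\<Sum>w\<in>C. if w = v then c v * (v \<bullet> v) else 0)"
        using C(3) that by (intro sum.cong) (auto simp: pairwise_def orthogonal_def)
      finally show ?thesis
        using that C(1) by simp
    qed
    \<comment> \<open>The orthogonal spanning set may contain 0. Its coefficient is 0 by division by
      zero, and the term vanishes whatever \<open>c v\<close> is.\<close>
    then have "(u \<bullet> v / (v \<bullet> v)) *\<^sub>R v = c v *\<^sub>R v" if "v \<in> C" for v
      using that by (cases "v = 0") auto
    then have "(\<Sum>v\<in>C. (u \<bullet> v / (v \<bullet> v)) *\<^sub>R v) = (\<Sum>v\<in>C. c v *\<^sub>R v)"
      by (rule sum.cong[OF refl])
    then show ?thesis
      using u by metis
  qed
  with that C(1) show ?thesis by blast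
qed

text \<open>Adding one vector w makes the new box the continuous image of an interval times the old
  box. Linear independence plays no part, so the orthogonal spanning set can be used as it
  is.\<close>

lemma compact_coordinate_box:
  fixes C :: "'a::real_inner set"
  assumes "finite C"
  shows "compact {\<Sum>v\<in>C. c v *\<^sub>R v | c. \<forall>v\<in>C. \<bar>c v\<bar> \<le> r v}"
  using assms
proof (induction C)
  case (insert w C)
  let ?K = "{\<Sum>v\<in>C. c v *\<^sub>R v | c. \<forall>v\<in>C. \<bar>c v\<bar> \<le> r v}"
  have "{\<Sum>v\<in>insert w C. c v *\<^sub>R v | c. \<forall>v\<in>insert w C. \<bar>c v\<bar> \<le> r v} =
      (\<lambda>(s, k). s *\<^sub>R w + k) ` ({- r w..r w} \<times> ?K)" (is "?A = ?B")
  proof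
    show "?A \<subseteq> ?B"
    proof clarify
      fix c assume "\<forall>v\<in>insert w C. \<bar>c v\<bar> \<le> r v"
      with insert.hyps show "(\<Sum>v\<in>insert w C. c v *\<^sub>R v) \<in> ?B"
        by (intro image_eqI[of _ _ "(c w, \<Sum>v\<in>C. c v *\<^sub>R v)"]) (auto simp: abs_le_iff)
    qed
    show "?B \<subseteq> ?A"
    proof clarify
      fix s c assume "s \<in> {- r w..r w}" "\<forall>v\<in>C. \<bar>c v\<bar> \<le> r v"
      with insert show "\<exists>d. s *\<^sub>R w + (\<Sum>v\<in>C. c v *\<^sub>R v) = (\<Sum>v\<in>insert w C. d v *\<^sub>R v) \<and>
          (\<forall>v\<in>insert w C. \<bar>d v\<bar> \<le> r v)"
        by (intro exI[of _ "c(w := s)"]) (auto simp: abs_le_iff intro!: sum.cong)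
    qed
  qed
  moreover have "compact ?B"
    unfolding case_prod_beta
    by (intro compact_continuous_image compact_Times insert.IH compact_Icc continuous_intros)
  ultimately show ?case by simp
qed simp

text \<open>By Cauchy-Schwarz the coordinates of x - a are bounded by \<open>r / norm v\<close>, so
  the ball lies in a translated compact box. Being closed, it equals its intersection with that box
  and is compact.\<close>

lemma compact_cball_finite_dim:
  assumes "finite_dim TYPE('a::real_inner)"
  shows "compact (cball (a :: 'a::real_inner) r)"
proof -
  obtain C :: "'a set" where C: "finite C" "\<And>u. u = (\<Sum>v\<in>C. (u \<bullet> v / (v \<bullet> v)) *\<^sub>R v)"
    using finite_dim_orthogonal_basis[OF assms] by blast
  let ?K = "{\<Sum>v\<in>C. c v *\<^sub>R v | c. \<forall>v\<in>C. \<bar>c v\<bar> \<le> r / norm v}"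
  have "x \<in> (\<lambda>u. a + u) ` ?K" if "x \<in> cball a r" for x
  proof -
    have "\<bar>(x - a) \<bullet> v / (v \<bullet> v)\<bar> \<le> r / norm v" if "v \<in> C" for v
    proof (cases "v = 0")
      case False
      have "\<bar>(x - a) \<bullet> v\<bar> \<le> r * norm v"
        by (rule order_trans[OF Cauchy_Schwarz_ineq2])
          (use \<open>x \<in> cball a r\<close> in \<open>auto intro!: mult_right_mono simp: dist_norm norm_minus_commute\<close>)
      then show ?thesis
        using False by (simp add: divide_simps power2_eq_square flip: power2_norm_eq_inner)
    qed simp
    then have "x - a \<in> ?K"
      by (intro CollectI exI[of _ "\<lambda>v. (x - a) \<bullet> v / (v \<bullet> v)"] conjI C(2)) simp
    then show ?thesis
      by (rule rev_image_eqI) simp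
  qed
  then have eq: "cball a r \<inter> (\<lambda>u. a + u) ` ?K = cball a r" by blast
  have "compact (cball a r \<inter> (\<lambda>u. a + u) ` ?K)"
    by (intro closed_Int_compact closed_cball compact_continuous_image compact_coordinate_box C(1)
        continuous_intros)
  then show ?thesis
    unfolding eq .
qed


section \<open>Smooth functions on manifolds\<close>

lemma manifold_chartD:
  assumes "smooth_manifold A" "(U, \<phi>) \<in> A"
  shows "open U" "open (\<phi> ` U)" "homeomorphism U (\<phi> ` U) \<phi> (inv_into U \<phi>)"
    and "\<And>x. x \<in> U \<Longrightarrow> inv_into U \<phi> (\<phi> x) = x"
    and "open W \<Longrightarrow> open (\<phi> ` (U \<inter> W))"
proof -
  show U: "open U" "open (\<phi> ` U)" "homeomorphism U (\<phi> ` U) \<phi> (inv_into U \<phi>)"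
    using assms unfolding smooth_manifold_def by fast+
  show "\<And>x. x \<in> U \<Longrightarrow> inv_into U \<phi> (\<phi> x) = x"
    using U(3) by (simp add: homeomorphism_def)
  show "open (\<phi> ` (U \<inter> W))" if "open W"
    using homeomorphism_imp_open_map[OF U(3), of "U \<inter> W"] U(2) that
    by (auto intro: openin_open_trans)
qed

lemma manifold_chart_exists:
  assumes "smooth_manifold A"
  obtains U \<phi> where "(U, \<phi>) \<in> A" "x \<in> U"
proof -
  have "x \<in> (\<Union>(U, \<phi>)\<in>A. U)"
    using assms by (simp add: smooth_manifold_def)
  with that show ?thesis by auto
qed

lemma smooth_inI:
  "(\<And>U \<phi>. (U, \<phi>) \<in> A \<Longrightarrow> smooth_on (\<phi> ` (U \<inter> W)) (\<lambda>z. f (inv_into U \<phi> z))) \<Longrightarrow> smooth_in A W f"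
  by (auto simp: smooth_in_def)

lemma smooth_inD:
  "smooth_in A W f \<Longrightarrow> (U, \<phi>) \<in> A \<Longrightarrow> smooth_on (\<phi> ` (U \<inter> W)) (\<lambda>z. f (inv_into U \<phi> z))"
  by (auto simp: smooth_in_def)

lemma smooth_in_cong:
  assumes "smooth_manifold A" "open W" "\<And>x. x \<in> W \<Longrightarrow> f x = g x"
  shows "smooth_in A W f \<longleftrightarrow> smooth_in A W g"
proof -
  have "smooth_on (\<phi> ` (U \<inter> W)) (\<lambda>z. f (inv_into U \<phi> z)) \<longleftrightarrow>
      smooth_on (\<phi> ` (U \<inter> W)) (\<lambda>z. g (inv_into U \<phi> z))" if "(U, \<phi>) \<in> A" for U \<phi>
    using manifold_chartD(4)[OF assms(1) that] assms(3)
    by (intro smooth_on_cong manifold_chartD(5)[OF assms(1) that] assms(2)) auto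
  then show ?thesis
    unfolding smooth_in_def by blast
qed

lemma smooth_in_subset: "smooth_in A W f \<Longrightarrow> V \<subseteq> W \<Longrightarrow> smooth_in A V f"
  by (rule smooth_inI, rule smooth_on_subset[OF smooth_inD]) auto

lemma smooth_in_local:
  assumes "smooth_manifold A" "\<And>x. x \<in> W \<Longrightarrow> \<exists>V. open V \<and> x \<in> V \<and> smooth_in A V f"
  shows "smooth_in A W f"
  unfolding smooth_in_def
proof clarify
  fix U \<phi> assume c: "(U, \<phi>) \<in> A"
  show "smooth_on (\<phi> ` (U \<inter> W)) (\<lambda>z. f (inv_into U \<phi> z))"
  proof (rule smooth_on_local)
    fix z assume "z \<in> \<phi> ` (U \<inter> W)"
    then obtain x where x: "x \<in> U" "x \<in> W" "z = \<phi> x" by auto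
    then obtain V where "open V" "x \<in> V" "smooth_in A V f"
      using assms(2) by blast
    then show "\<exists>T. open T \<and> z \<in> T \<and> smooth_on T (\<lambda>z. f (inv_into U \<phi> z))"
      using x c manifold_chartD(5)[OF assms(1) c]
      by (intro exI[of _ "\<phi> ` (U \<inter> V)"]) (auto simp: smooth_in_def)
  qed
qed

lemma smooth_in_const: "smooth_manifold A \<Longrightarrow> open W \<Longrightarrow> smooth_in A W (\<lambda>x. c)"
  by (rule smooth_inI) (intro smooth_on_const manifold_chartD(5))

lemma smooth_in_add:
  "smooth_manifold A \<Longrightarrow> open W \<Longrightarrow> smooth_in A W f \<Longrightarrow> smooth_in A W g \<Longrightarrow>
    smooth_in A W (\<lambda>x. f x + g x)"
  by (rule smooth_inI) (intro smooth_on_add manifold_chartD(5) smooth_inD)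

lemma smooth_in_bilinear:
  assumes "bounded_bilinear p" "smooth_manifold A" "open W" "smooth_in A W f" "smooth_in A W g"
  shows "smooth_in A W (\<lambda>x. p (f x) (g x))"
  by (rule smooth_inI, rule smooth_on_bilinear[OF assms(1)])
    (use assms in \<open>auto intro: manifold_chartD(5) smooth_inD\<close>)

lemmas smooth_in_mult = smooth_in_bilinear[OF bounded_bilinear_mult]
  and smooth_in_scaleR = smooth_in_bilinear[OF bounded_bilinear_scaleR]
  and smooth_in_inner = smooth_in_bilinear[OF bounded_bilinear_inner]

lemma smooth_in_compose_real:
  fixes h :: "real \<Rightarrow> real"
  assumes "smooth_manifold A" "open W" "smooth_on UNIV h" "smooth_in A W g"
  shows "smooth_in A W (\<lambda>x. h (g x))"
  by (rule smooth_inI, rule smooth_on_compose_real[OF _ assms(3)])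
    (use assms in \<open>auto intro: manifold_chartD(5) smooth_inD\<close>)

lemma smooth_in_sum:
  assumes "smooth_manifold A" "open W" "finite I" "\<And>i. i \<in> I \<Longrightarrow> smooth_in A W (f i)"
  shows "smooth_in A W (\<lambda>x. \<Sum>i\<in>I. f i x)"
  using assms(3,4)
  by (induction I) (auto intro: smooth_in_const smooth_in_add assms(1,2))

text \<open>Smoothness of a chart, tested in the other charts, is the compatibility condition on the
  atlas.\<close>

lemma smooth_in_chart: "smooth_manifold A \<Longrightarrow> (U, \<phi>) \<in> A \<Longrightarrow> smooth_in A U \<phi>"
  unfolding smooth_manifold_def smooth_in_def by fast

text \<open>A radial profile in a chart, extended by 0. Besides vanishing outside W, the function
  must vanish off a set K that is closed in the whole manifold: this is what later allows objects
  defined only over W to be extended by zero.\<close>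

lemma bump_function_exists:
  assumes A: "smooth_manifold (A :: ('m::{t2_space, second_countable_topology}, 'b::real_inner) atlas)"
    and "open W" "p \<in> W"
  obtains \<beta> K where "smooth_fun A \<beta>" "\<beta> p = 1" "closed K" "K \<subseteq> W" "\<And>x. x \<notin> K \<Longrightarrow> \<beta> x = 0"
proof -
  obtain U \<phi> where c: "(U, \<phi>) \<in> A" "p \<in> U"
    using manifold_chart_exists[OF A] .
  note chart = manifold_chartD[OF A c(1)]
  have "open (\<phi> ` (U \<inter> W))" "\<phi> p \<in> \<phi> ` (U \<inter> W)"
    using chart(5) assms(2,3) c(2) by auto
  then obtain r where r: "r > 0" "cball (\<phi> p) r \<subseteq> \<phi> ` (U \<inter> W)"
    unfolding open_contains_cball by blast
  define K where "K = inv_into U \<phi> ` cball (\<phi> p) r"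
  \<comment> \<open>The argument s is a squared distance, which is smooth at the centre, unlike the
    distance. The profile vanishes once s reaches \<open>r\<^sup>2\<close>, and the denominator
    makes it 1 at s = 0.\<close>
  define h where "h s = flat_exp 0 (r\<^sup>2 - s) / flat_exp 0 (r\<^sup>2)" for s
  define \<beta> where "\<beta> x = (if x \<in> U then h ((\<phi> x - \<phi> p) \<bullet> (\<phi> x - \<phi> p)) else 0)" for x
  have "compact (cball (\<phi> p) r)"
    using A by (intro compact_cball_finite_dim) (simp add: smooth_manifold_def)
  moreover have "continuous_on (cball (\<phi> p) r) (inv_into U \<phi>)"
    using chart(3) r(2) by (auto simp: homeomorphism_def intro: continuous_on_subset)
  ultimately have "compact K"
    unfolding K_def by (rule compact_continuous_image[rotated])
  then have "closed K"
    by (rule compact_imp_closed)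
  have "K \<subseteq> U \<inter> W"
    using r(2) chart(4) unfolding K_def by fastforce
  have "0 < flat_exp 0 (r\<^sup>2)"
    using r(1) by (simp add: flat_exp_def)
  then have "\<beta> p = 1"
    using c(2) by (simp add: \<beta>_def h_def)
  have zero: "\<beta> x = 0" if "x \<notin> K" for x
  proof (cases "x \<in> U")
    case True
    have "\<phi> x \<notin> cball (\<phi> p) r"
      using that chart(4)[OF True] unfolding K_def by (metis image_eqI)
    then have "r \<le> norm (\<phi> x - \<phi> p)"
      by (simp add: dist_norm norm_minus_commute)
    then have "r\<^sup>2 \<le> (norm (\<phi> x - \<phi> p))\<^sup>2"
      using r(1) by (intro power_mono) auto
    then show ?thesis
      by (simp add: \<beta>_def h_def flat_exp_def power2_norm_eq_inner)
  qed (simp add: \<beta>_def)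
  have lin: "smooth_on UNIV (\<lambda>s. a * s)" for a :: real
    unfolding smooth_on_def by (intro allI C_k_on_linear open_UNIV bounded_linear_mult_right)
  have "smooth_on UNIV (\<lambda>s. r\<^sup>2 + (- 1) * s)"
    by (intro smooth_on_add smooth_on_const lin open_UNIV)
  then have "smooth_on UNIV (\<lambda>s. flat_exp 0 (r\<^sup>2 + (- 1) * s))"
    by (rule smooth_on_compose_real[OF open_UNIV smooth_on_flat_exp])
  then have "smooth_on UNIV (\<lambda>s. 1 / flat_exp 0 (r\<^sup>2) * flat_exp 0 (r\<^sup>2 + (- 1) * s))"
    by (rule smooth_on_compose_real[OF open_UNIV lin])
  then have h: "smooth_on UNIV h"
    by (simp add: h_def[abs_def])
  have diff: "smooth_in A U (\<lambda>x. \<phi> x + (- \<phi> p))"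
    by (intro smooth_in_add smooth_in_const smooth_in_chart A c chart)
  have "smooth_in A U (\<lambda>x. h ((\<phi> x + (- \<phi> p)) \<bullet> (\<phi> x + (- \<phi> p))))"
    by (intro smooth_in_compose_real[OF _ _ h] smooth_in_inner diff A chart)
  then have on_U: "smooth_in A U \<beta>"
    by (rule smooth_in_cong[OF A chart(1), THEN iffD1, rotated]) (simp add: \<beta>_def)
  have "smooth_in A (- K) \<beta>"
    using smooth_in_cong[OF A, of "- K" \<beta> "\<lambda>_. 0"] zero smooth_in_const[OF A, of "- K" 0] \<open>closed K\<close>
    by auto
  \<comment> \<open>U and the complement of K are open and cover the manifold. The complement is
    open because K, as a compact subset of a Hausdorff space, is closed.\<close>
  then have "smooth_fun A \<beta>"
    using on_U chart(1) \<open>K \<subseteq> U \<inter> W\<close> \<open>closed K\<close>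
    by (intro smooth_in_local[OF A]) (metis ComplI Int_subset_iff open_Compl subsetD)
  with that show ?thesis
    using \<open>\<beta> p = 1\<close> \<open>closed K\<close> \<open>K \<subseteq> U \<inter> W\<close> zero by blast
qed


section \<open>Sections and forms of vector bundles\<close>

locale smooth_bundle =
  fixes E :: "('m::{t2_space, second_countable_topology}, 'b::real_inner, 'e, 'f::real_inner, 'z)
    vbundle_scheme"
  assumes vb: "vector_bundle E"
begin

lemma mfd: "smooth_manifold (base E)"
  using vb by (simp add: vector_bundle_def)

lemma fin: "finite_dim TYPE('f)"
  using vb by (simp add: vector_bundle_def)

lemma fadd_fibre: "a \<in> fibre E x \<Longrightarrow> b \<in> fibre E x \<Longrightarrow> fadd E a b \<in> fibre E x"
  using vb by (auto simp: vector_bundle_def)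

lemma fscale_fibre: "a \<in> fibre E x \<Longrightarrow> fscale E c a \<in> fibre E x"
  using vb by (auto simp: vector_bundle_def)

lemma triv_exists: obtains U \<tau> where "(U, \<tau>) \<in> trivs E" "x \<in> U"
proof -
  have "x \<in> (\<Union>(U, \<tau>)\<in>trivs E. U)"
    using vb by (simp add: vector_bundle_def)
  with that show ?thesis by auto
qed

context
  fixes U \<tau>
  assumes triv: "(U, \<tau>) \<in> trivs E"
begin

lemma triv_props:
  "open U \<and> (\<forall>x\<in>U. bij_betw \<tau> (fibre E x) UNIV \<and>
     (\<forall>a\<in>fibre E x. \<forall>b\<in>fibre E x. \<tau> (fadd E a b) = \<tau> a + \<tau> b) \<and>
     (\<forall>c. \<forall>a\<in>fibre E x. \<tau> (fscale E c a) = c *\<^sub>R \<tau> a))"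
proof -
  have "\<forall>(U, \<tau>)\<in>trivs E. open U \<and> (\<forall>x\<in>U. bij_betw \<tau> (fibre E x) UNIV \<and>
     (\<forall>a\<in>fibre E x. \<forall>b\<in>fibre E x. \<tau> (fadd E a b) = \<tau> a + \<tau> b) \<and>
     (\<forall>c. \<forall>a\<in>fibre E x. \<tau> (fscale E c a) = c *\<^sub>R \<tau> a))"
    using vb unfolding vector_bundle_def by (elim conjE)
  from bspec[OF this triv] show ?thesis
    unfolding prod.case .
qed

lemma triv_open: "open U"
  using triv_props ..

lemma triv_bij: "x \<in> U \<Longrightarrow> bij_betw \<tau> (fibre E x) UNIV"
  using triv_props by blast

lemma triv_add:
  "x \<in> U \<Longrightarrow> a \<in> fibre E x \<Longrightarrow> b \<in> fibre E x \<Longrightarrow> \<tau> (fadd E a b) = \<tau> a + \<tau> b"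
  using triv_props by blast

lemma triv_scale: "x \<in> U \<Longrightarrow> a \<in> fibre E x \<Longrightarrow> \<tau> (fscale E c a) = c *\<^sub>R \<tau> a"
  using triv_props by blast

lemma triv_transition:
  assumes "(V, \<sigma>) \<in> trivs E"
  shows "smooth_in (base E) (U \<inter> V) (\<lambda>x. \<sigma> (inv_into (fibre E x) \<tau> v))"
proof -
  have "\<forall>(U, \<tau>)\<in>trivs E. \<forall>(V, \<sigma>)\<in>trivs E. \<forall>v.
      smooth_in (base E) (U \<inter> V) (\<lambda>x. \<sigma> (inv_into (fibre E x) \<tau> v))"
    using vb unfolding vector_bundle_def by (elim conjE)
  from bspec[OF bspec[OF this triv, unfolded prod.case] assms] show ?thesis
    by simp
qed

lemma triv_eqI:
  "x \<in> U \<Longrightarrow> a \<in> fibre E x \<Longrightarrow> b \<in> fibre E x \<Longrightarrow> \<tau> a = \<tau> b \<Longrightarrow> a = b"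
  using triv_bij by (auto simp: bij_betw_def inj_on_def)

lemma triv_inv_fibre: "x \<in> U \<Longrightarrow> inv_into (fibre E x) \<tau> v \<in> fibre E x"
  using triv_bij by (auto simp: bij_betw_def intro!: inv_into_into)

lemma triv_inv: "x \<in> U \<Longrightarrow> \<tau> (inv_into (fibre E x) \<tau> v) = v"
  using triv_bij by (auto simp: bij_betw_def intro!: f_inv_into_f)

lemma inv_triv: "x \<in> U \<Longrightarrow> a \<in> fibre E x \<Longrightarrow> inv_into (fibre E x) \<tau> (\<tau> a) = a"
  using triv_bij by (auto simp: bij_betw_def)

end

text \<open>The bundle record carries no zero vector. Scaling any element of the fibre by 0 produces
  it, and every trivialization confirms that the choice does not matter.\<close>

definition zero_section :: "'m \<Rightarrow> 'e" where
  "zero_section x = fscale E 0 (SOME e. e \<in> fibre E x)"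

lemma zero_section_fibre: "zero_section x \<in> fibre E x"
proof -
  obtain U \<tau> where "(U, \<tau>) \<in> trivs E" "x \<in> U" using triv_exists .
  then have "fibre E x \<noteq> {}"
    using triv_inv_fibre by blast
  then show ?thesis
    by (simp add: zero_section_def fscale_fibre some_in_eq)
qed

lemma triv_zero: "(U, \<tau>) \<in> trivs E \<Longrightarrow> x \<in> U \<Longrightarrow> \<tau> (zero_section x) = 0"
  using zero_section_fibre[of x] triv_inv_fibre[of U \<tau> x]
  by (metis scale_eq_0_iff someI_ex triv_scale zero_section_def)

section \<open>Smooth sections and cut-off local frames\<close>

lemma smooth_sectionI:
  "(\<And>x. X x \<in> fibre E x) \<Longrightarrow>
    (\<And>U \<tau>. (U, \<tau>) \<in> trivs E \<Longrightarrow> smooth_in (base E) U (\<lambda>x. \<tau> (X x))) \<Longrightarrow> smooth_section E X"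
  by (auto simp: smooth_section_def)

lemma smooth_section_fibre: "smooth_section E X \<Longrightarrow> X x \<in> fibre E x"
  by (simp add: smooth_section_def)

lemma smooth_section_triv:
  "smooth_section E X \<Longrightarrow> (U, \<tau>) \<in> trivs E \<Longrightarrow> smooth_in (base E) U (\<lambda>x. \<tau> (X x))"
  by (auto simp: smooth_section_def)

lemma smooth_section_sadd:
  assumes X: "smooth_section E X" and Y: "smooth_section E Y"
  shows "smooth_section E (sadd E X Y)"
proof (rule smooth_sectionI)
  show "sadd E X Y x \<in> fibre E x" for x
    using X Y by (simp add: sadd_def fadd_fibre smooth_section_fibre)
next
  fix U \<tau> assume t: "(U, \<tau>) \<in> trivs E"
  have "smooth_in (base E) U (\<lambda>x. \<tau> (X x) + \<tau> (Y x))"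
    by (intro smooth_in_add mfd triv_open[OF t] smooth_section_triv[OF _ t] X Y)
  then show "smooth_in (base E) U (\<lambda>x. \<tau> (sadd E X Y x))"
    by (rule smooth_in_cong[OF mfd triv_open[OF t], THEN iffD1, rotated])
      (simp add: sadd_def triv_add[OF t] smooth_section_fibre X Y)
qed

lemma smooth_section_sscale:
  assumes f: "smooth_fun (base E) f" and X: "smooth_section E X"
  shows "smooth_section E (sscale E f X)"
proof (rule smooth_sectionI)
  show "sscale E f X x \<in> fibre E x" for x
    using X by (simp add: sscale_def fscale_fibre smooth_section_fibre)
next
  fix U \<tau> assume t: "(U, \<tau>) \<in> trivs E"
  have "smooth_in (base E) U (\<lambda>x. f x *\<^sub>R \<tau> (X x))"
    by (intro smooth_in_scaleR mfd triv_open[OF t] smooth_section_triv[OF _ t] X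
        smooth_in_subset[OF f]) auto
  then show "smooth_in (base E) U (\<lambda>x. \<tau> (sscale E f X x))"
    by (rule smooth_in_cong[OF mfd triv_open[OF t], THEN iffD1, rotated])
      (simp add: sscale_def triv_scale[OF t] smooth_section_fibre X)
qed

text \<open>The section that is constantly v in the trivialization exists only over U. Damping it by
  \<beta> gives a global section, to which bracket and anchor apply.\<close>

definition cutoff_frame :: "('m \<Rightarrow> real) \<Rightarrow> 'm set \<Rightarrow> ('e \<Rightarrow> 'f) \<Rightarrow> 'f \<Rightarrow> 'm \<Rightarrow> 'e" where
  "cutoff_frame \<beta> U \<tau> v x =
    (if x \<in> U then fscale E (\<beta> x) (inv_into (fibre E x) \<tau> v) else zero_section x)"

text \<open>Seen in another trivialization over V, the section is \<beta> times a smooth transition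
  map on U \<inter> V and zero on V - K. These two open sets cover V since K lies in U.\<close>

lemma smooth_cutoff_frame:
  assumes t: "(U, \<tau>) \<in> trivs E" and \<beta>: "smooth_fun (base E) \<beta>"
    and K: "closed K" "K \<subseteq> U" "\<And>x. x \<notin> K \<Longrightarrow> \<beta> x = 0"
  shows "smooth_section E (cutoff_frame \<beta> U \<tau> v)"
proof (rule smooth_sectionI)
  show "cutoff_frame \<beta> U \<tau> v x \<in> fibre E x" for x
    by (simp add: cutoff_frame_def fscale_fibre triv_inv_fibre[OF t] zero_section_fibre)
next
  fix V \<sigma> assume s: "(V, \<sigma>) \<in> trivs E"
  have "smooth_in (base E) (U \<inter> V) (\<lambda>x. \<beta> x *\<^sub>R \<sigma> (inv_into (fibre E x) \<tau> v))"
    by (intro smooth_in_scaleR mfd open_Int triv_open[OF t] triv_open[OF s]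
        triv_transition[OF t s] smooth_in_subset[OF \<beta>]) auto
  then have 1: "smooth_in (base E) (U \<inter> V) (\<lambda>x. \<sigma> (cutoff_frame \<beta> U \<tau> v x))"
    by (rule smooth_in_cong[OF mfd, THEN iffD1, rotated 2])
      (auto simp: open_Int triv_open[OF t] triv_open[OF s] cutoff_frame_def
        triv_scale[OF s] triv_inv_fibre[OF t])
  have "smooth_in (base E) (V - K) (\<lambda>x. 0 :: 'f)"
    by (intro smooth_in_const mfd open_Diff triv_open[OF s] K)
  then have 2: "smooth_in (base E) (V - K) (\<lambda>x. \<sigma> (cutoff_frame \<beta> U \<tau> v x))"
    by (rule smooth_in_cong[OF mfd, THEN iffD1, rotated 2])
      (auto simp: open_Diff K(1,3) triv_open[OF s] cutoff_frame_def
        triv_scale[OF s] triv_inv_fibre[OF t] triv_zero[OF s])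
  show "smooth_in (base E) V (\<lambda>x. \<sigma> (cutoff_frame \<beta> U \<tau> v x))"
  proof (rule smooth_in_local[OF mfd])
    fix x assume "x \<in> V"
    then show "\<exists>T. open T \<and> x \<in> T \<and> smooth_in (base E) T (\<lambda>x. \<sigma> (cutoff_frame \<beta> U \<tau> v x))"
      using 1 2 K(1,2) triv_open[OF t] triv_open[OF s]
      by (cases "x \<in> U") (blast, metis Diff_iff open_Diff subsetD)
  qed
qed

lemma smooth_section_through:
  assumes e: "e \<in> fibre E p"
  obtains X where "smooth_section E X" "X p = e"
proof -
  obtain U \<tau> where t: "(U, \<tau>) \<in> trivs E" "p \<in> U" using triv_exists .
  obtain \<beta> K where \<beta>: "smooth_fun (base E) \<beta>" "\<beta> p = 1" "closed K" "K \<subseteq> U"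
      "\<And>x. x \<notin> K \<Longrightarrow> \<beta> x = 0"
    using bump_function_exists[OF mfd triv_open[OF t(1)] t(2)] by blast
  have "cutoff_frame \<beta> U \<tau> (\<tau> e) p = e"
    by (rule triv_eqI[OF t])
      (simp_all add: cutoff_frame_def t(2) \<beta>(2) e fscale_fibre inv_triv[OF t] triv_scale[OF t])
  with that smooth_cutoff_frame[OF t(1) \<beta>(1,3,4,5)] show ?thesis by blast
qed

lemma sections_through:
  assumes "set es \<subseteq> fibre E p"
  obtains Xs where "\<forall>X\<in>set Xs. smooth_section E X" "map (\<lambda>X. X p) Xs = es"
  using assms
proof (induction es arbitrary: thesis)
  case (Cons e es)
  then obtain Xs where "\<forall>X\<in>set Xs. smooth_section E X" "map (\<lambda>X. X p) Xs = es" by auto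
  moreover obtain X where "smooth_section E X" "X p = e"
    using smooth_section_through Cons.prems(2) by auto
  ultimately show ?case
    using Cons.prems(1)[of "X # Xs"] by simp
qed simp

section \<open>Forms of degree 0 and 1 evaluated on sections\<close>

lemma smooth_form_triv:
  assumes "smooth_form E k \<omega>" "(U, \<tau>) \<in> trivs E" "length vs = k"
  shows "smooth_in (base E) U (\<lambda>x. \<omega> x (map (inv_into (fibre E x) \<tau>) vs))"
proof -
  have "\<forall>(U, \<tau>)\<in>trivs E. \<forall>vs. length vs = k \<longrightarrow>
      smooth_in (base E) U (\<lambda>x. \<omega> x (map (inv_into (fibre E x) \<tau>) vs))"
    using assms(1) unfolding smooth_form_def by (elim conjE)
  from bspec[OF this assms(2)] show ?thesis
    using assms(3) by simp
qed

lemma smooth_form_zero: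
  "smooth_form E k \<omega> \<Longrightarrow> \<not> (length es = k \<and> set es \<subseteq> fibre E x) \<Longrightarrow> \<omega> x es = 0"
  unfolding smooth_form_def by blast

lemma form_add:
  assumes "smooth_form E 1 \<omega>" "a \<in> fibre E x" "b \<in> fibre E x"
  shows "\<omega> x [fadd E a b] = \<omega> x [a] + \<omega> x [b]"
  using assms unfolding smooth_form_def
  by (elim conjE allE[of _ x] allE[of _ "[a]"] allE[of _ 0]) auto

lemma form_scale:
  assumes "smooth_form E 1 \<omega>" "a \<in> fibre E x"
  shows "\<omega> x [fscale E c a] = c * \<omega> x [a]"
  using assms unfolding smooth_form_def
  by (elim conjE allE[of _ x] allE[of _ "[a]"] allE[of _ 0]) auto

lemma linear_form_triv:
  assumes \<omega>: "smooth_form E 1 \<omega>" and t: "(U, \<tau>) \<in> trivs E" "x \<in> U"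
  shows "linear (\<lambda>v. \<omega> x [inv_into (fibre E x) \<tau> v])"
proof
  note inv = triv_inv_fibre[OF t] triv_inv[OF t]
  have "inv_into (fibre E x) \<tau> (u + v) =
      fadd E (inv_into (fibre E x) \<tau> u) (inv_into (fibre E x) \<tau> v)" for u v
    by (rule triv_eqI[OF t]) (simp_all add: inv fadd_fibre triv_add[OF t])
  then show "\<omega> x [inv_into (fibre E x) \<tau> (u + v)] =
      \<omega> x [inv_into (fibre E x) \<tau> u] + \<omega> x [inv_into (fibre E x) \<tau> v]" for u v
    by (simp add: form_add[OF \<omega>] inv)
  have "inv_into (fibre E x) \<tau> (c *\<^sub>R v) = fscale E c (inv_into (fibre E x) \<tau> v)" for c v
    by (rule triv_eqI[OF t]) (simp_all add: inv fscale_fibre triv_scale[OF t])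
  then show "\<omega> x [inv_into (fibre E x) \<tau> (c *\<^sub>R v)] = c *\<^sub>R \<omega> x [inv_into (fibre E x) \<tau> v]" for c v
    by (simp add: form_scale[OF \<omega>] inv)
qed

text \<open>A smooth form is required to be smooth only on the constant local sections of a
  trivialization. Expanding \<open>\<tau> (X x)\<close> in an orthogonal spanning set reduces to
  these, with inner products as smooth coefficients.\<close>

lemma smooth_form_eval:
  assumes \<omega>: "smooth_form E 1 \<omega>" and X: "smooth_section E X"
  shows "smooth_fun (base E) (\<lambda>x. \<omega> x [X x])"
proof (rule smooth_in_local[OF mfd])
  fix p :: 'm
  obtain U \<tau> where t: "(U, \<tau>) \<in> trivs E" "p \<in> U" using triv_exists .
  obtain C :: "'f set" where C: "finite C" "\<And>u. u = (\<Sum>v\<in>C. (u \<bullet> v / (v \<bullet> v)) *\<^sub>R v)"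
    using finite_dim_orthogonal_basis[OF fin] by blast
  have "\<omega> x [X x] = (\<Sum>v\<in>C. (\<tau> (X x) \<bullet> v) * (1 / (v \<bullet> v)) * \<omega> x [inv_into (fibre E x) \<tau> v])"
    if "x \<in> U" for x
  proof -
    interpret linear "\<lambda>v. \<omega> x [inv_into (fibre E x) \<tau> v]"
      using linear_form_triv[OF \<omega> t(1) that] .
    have "\<omega> x [X x] = \<omega> x [inv_into (fibre E x) \<tau> (\<tau> (X x))]"
      by (simp add: inv_triv[OF t(1) that] smooth_section_fibre[OF X])
    also have "\<dots> = (\<Sum>v\<in>C. (\<tau> (X x) \<bullet> v / (v \<bullet> v)) *\<^sub>R \<omega> x [inv_into (fibre E x) \<tau> v])"
      by (subst C(2)[of "\<tau> (X x)"]) (simp only: sum scale)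
    finally show ?thesis by simp
  qed
  moreover have form: "smooth_in (base E) U (\<lambda>x. \<omega> x [inv_into (fibre E x) \<tau> v])" for v
    using smooth_form_triv[OF \<omega> t(1), of "[v]"] by simp
  moreover have "smooth_in (base E) U
      (\<lambda>x. \<Sum>v\<in>C. (\<tau> (X x) \<bullet> v) * (1 / (v \<bullet> v)) * \<omega> x [inv_into (fibre E x) \<tau> v])"
    by (intro smooth_in_sum smooth_in_mult smooth_in_inner smooth_in_const form mfd
        triv_open[OF t(1)] smooth_section_triv[OF X t(1)] C(1))
  ultimately have "smooth_in (base E) U (\<lambda>x. \<omega> x [X x])"
    using smooth_in_cong[OF mfd triv_open[OF t(1)], of "\<lambda>x. \<omega> x [X x]"] by simp
  then show "\<exists>V. open V \<and> p \<in> V \<and> smooth_in (base E) V (\<lambda>x. \<omega> x [X x])"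
    using triv_open t by blast
qed

text \<open>The usual tensoriality argument: K X is computed as a combination of the values of K on
  cut-off frame sections, with the coordinates of X p as coefficients. The frame sections do not
  depend on X, so X enters only through X p.\<close>

lemma section_functional_pointwise:
  assumes add: "\<And>X Y. smooth_section E X \<Longrightarrow> smooth_section E Y \<Longrightarrow> K (sadd E X Y) = K X + (K Y :: real)"
    and scale: "\<And>f X. smooth_fun (base E) f \<Longrightarrow> smooth_section E X \<Longrightarrow> K (sscale E f X) = f p * K X"
    and X: "smooth_section E X" and Y: "smooth_section E Y" and eq: "X p = Y p"
  shows "K X = K Y"
proof -
  obtain U \<tau> where t: "(U, \<tau>) \<in> trivs E" "p \<in> U" using triv_exists .
  obtain \<beta> S where \<beta>: "smooth_fun (base E) \<beta>" "\<beta> p = 1" "closed S" "S \<subseteq> U"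
      "\<And>x. x \<notin> S \<Longrightarrow> \<beta> x = 0"
    using bump_function_exists[OF mfd triv_open[OF t(1)] t(2)] by blast
  obtain C :: "'f set" where C: "finite C" "\<And>u. u = (\<Sum>v\<in>C. (u \<bullet> v / (v \<bullet> v)) *\<^sub>R v)"
    using finite_dim_orthogonal_basis[OF fin] by blast
  have frame: "smooth_section E (cutoff_frame \<beta> U \<tau> v)" for v
    by (rule smooth_cutoff_frame[OF t(1) \<beta>(1,3,4,5)])
  have "K X = (\<Sum>v\<in>C. (\<tau> (X p) \<bullet> v / (v \<bullet> v)) * K (cutoff_frame \<beta> U \<tau> v))"
    if X: "smooth_section E X" for X
  proof -
    note Xf = smooth_section_fibre[OF X]
    define f where "f v x = (if x \<in> U then \<beta> x * ((\<tau> (X x) \<bullet> v) * (1 / (v \<bullet> v))) else 0)" for v x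
    \<comment> \<open>Partial sums of the frame expansion, multiplied by the square of \<beta>. They
      let K, which is additive only for two sections at a time, be computed by induction over the
      spanning set.\<close>
    define W where "W F x = (if x \<in> U
      then fscale E (\<beta> x * \<beta> x) (inv_into (fibre E x) \<tau> (\<Sum>v\<in>F. (\<tau> (X x) \<bullet> v / (v \<bullet> v)) *\<^sub>R v))
      else zero_section x)" for F x
    have f: "smooth_fun (base E) (f v)" for v
    proof (rule smooth_in_local[OF mfd])
      fix x :: 'm
      have "smooth_in (base E) U (\<lambda>x. \<beta> x * ((\<tau> (X x) \<bullet> v) * (1 / (v \<bullet> v))))"
        by (intro smooth_in_mult smooth_in_inner smooth_in_const mfd triv_open[OF t(1)]
            smooth_section_triv[OF X t(1)] smooth_in_subset[OF \<beta>(1)] subset_UNIV)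
      then have 1: "smooth_in (base E) U (f v)"
        by (rule smooth_in_cong[OF mfd triv_open[OF t(1)], THEN iffD1, rotated]) (simp add: f_def)
      have "smooth_in (base E) (- S) (\<lambda>x. 0 :: real)"
        using \<beta>(3) by (intro smooth_in_const mfd) auto
      then have 2: "smooth_in (base E) (- S) (f v)"
        by (rule smooth_in_cong[OF mfd, THEN iffD1, rotated 2])
          (use \<beta>(3,5) in \<open>auto simp: f_def\<close>)
      show "\<exists>V. open V \<and> x \<in> V \<and> smooth_in (base E) V (f v)"
      proof (cases "x \<in> U")
        case True
        then show ?thesis using 1 triv_open[OF t(1)] by blast
      next
        case False
        then show ?thesis using 2 \<beta>(3,4) by (intro exI[of _ "- S"]) auto
      qed
    qed
    \<comment> \<open>Writing the zero section as a multiple of X lets \<open>scale\<close> give K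
      (W {}) = 0. Outside U, where \<tau> says nothing, sections are compared in another
      trivialization.\<close>
    have W0: "W {} = sscale E (\<lambda>_. 0) X"
    proof
      fix x
      obtain V \<sigma> where s: "(V, \<sigma>) \<in> trivs E" "x \<in> V" using triv_exists .
      show "W {} x = sscale E (\<lambda>_. 0) X x"
      proof (cases "x \<in> U")
        case True
        show ?thesis
          by (rule triv_eqI[OF t(1) True])
            (simp_all add: W_def sscale_def True Xf fscale_fibre triv_inv_fibre[OF t(1)]
              triv_scale[OF t(1) True] triv_inv[OF t(1) True])
      next
        case False
        show ?thesis
          by (rule triv_eqI[OF s])
            (simp_all add: W_def sscale_def False Xf fscale_fibre zero_section_fibre
              triv_scale[OF s] triv_zero[OF s])
      qed
    qed
    have W1: "W (insert v F) = sadd E (sscale E (f v) (cutoff_frame \<beta> U \<tau> v)) (W F)"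
      if "v \<notin> F" "finite F" for v F
    proof
      fix x
      obtain V \<sigma> where s: "(V, \<sigma>) \<in> trivs E" "x \<in> V" using triv_exists .
      show "W (insert v F) x = sadd E (sscale E (f v) (cutoff_frame \<beta> U \<tau> v)) (W F) x"
      proof (cases "x \<in> U")
        case True
        show ?thesis
          by (rule triv_eqI[OF t(1) True])
            (simp_all add: W_def sscale_def sadd_def cutoff_frame_def f_def that True Xf fscale_fibre
              fadd_fibre triv_inv_fibre[OF t(1) True] triv_add[OF t(1) True]
              triv_scale[OF t(1) True] triv_inv[OF t(1) True] scaleR_add_right)
      next
        case False
        show ?thesis
          by (rule triv_eqI[OF s])
            (simp_all add: W_def sscale_def sadd_def cutoff_frame_def f_def False fscale_fibre
              fadd_fibre zero_section_fibre triv_add[OF s] triv_scale[OF s] triv_zero[OF s])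
      qed
    qed
    have W: "smooth_section E (W F) \<and>
        K (W F) = (\<Sum>v\<in>F. (\<tau> (X p) \<bullet> v / (v \<bullet> v)) * K (cutoff_frame \<beta> U \<tau> v))"
      if "finite F" for F
      using that
    proof (induction F)
      case empty
      have c: "smooth_fun (base E) (\<lambda>_. 0)"
        by (intro smooth_in_const mfd open_UNIV)
      show ?case
        unfolding W0 by (simp add: scale[OF c X] smooth_section_sscale[OF c X])
    next
      case (insert v F)
      then show ?case
        using W1[of v F] f[of v] frame[of v] t(2) \<beta>(2)
        by (simp add: smooth_section_sadd smooth_section_sscale add scale f_def)
    qed
    \<comment> \<open>The coefficient of the part of X not captured by the frame. It vanishes at p
      since \<beta> p = 1, so K does not see that part.\<close>
    have "smooth_in (base E) UNIV (\<lambda>x. 1 + (- 1) * (\<beta> x * \<beta> x))" (is "smooth_in _ _ ?g")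
      by (intro smooth_in_add smooth_in_mult smooth_in_const mfd open_UNIV \<beta>(1))
    note g = this
    have "X = sadd E (sscale E ?g X) (W C)"
    proof
      fix x
      obtain V \<sigma> where s: "(V, \<sigma>) \<in> trivs E" "x \<in> V" using triv_exists .
      show "X x = sadd E (sscale E ?g X) (W C) x"
      proof (cases "x \<in> U")
        case True
        show ?thesis
          by (rule triv_eqI[OF t(1) True])
            (simp_all add: W_def sscale_def sadd_def True Xf fscale_fibre fadd_fibre
              triv_inv_fibre[OF t(1) True] triv_add[OF t(1) True] triv_scale[OF t(1) True]
              triv_inv[OF t(1) True] C(2)[symmetric] flip: scaleR_add_left)
      next
        case False
        then have "\<beta> x = 0" using \<beta>(4,5) by blast
        then show ?thesis
          by (intro triv_eqI[OF s])
            (simp_all add: W_def sscale_def sadd_def False Xf fscale_fibre fadd_fibre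
              zero_section_fibre triv_add[OF s] triv_scale[OF s] triv_zero[OF s])
      qed
    qed
    then have "K X = K (sadd E (sscale E ?g X) (W C))" by (rule arg_cong)
    also have "\<dots> = K (sscale E ?g X) + K (W C)"
      by (intro add smooth_section_sscale g X W[OF C(1), THEN conjunct1])
    also have "K (sscale E ?g X) = 0"
      unfolding scale[OF g X] by (simp add: \<beta>(2))
    finally show ?thesis
      using W[OF C(1)] by simp
  qed
  from this[OF X] this[OF Y] show ?thesis
    by (simp only: eq)
qed

lemma smooth_form_eval_list:
  assumes \<omega>: "smooth_form E k \<omega>" "k \<le> 1" and Xs: "\<forall>X\<in>set Xs. smooth_section E X"
  shows "smooth_fun (base E) (\<lambda>x. \<omega> x (map (\<lambda>X. X x) Xs))"
proof -
  consider "length Xs \<noteq> k" | "k = 0" "Xs = []" | X where "k = 1" "Xs = [X]"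
    using \<omega>(2) by (cases Xs; cases "tl Xs"; cases k) auto
  then show ?thesis
  proof cases
    case 1
    then show ?thesis
      using smooth_in_const[OF mfd open_UNIV, of 0] by (simp add: smooth_form_zero[OF \<omega>(1)])
  next
    case 2
    show ?thesis
    proof (rule smooth_in_local[OF mfd])
      fix x :: 'm
      obtain U \<tau> where "(U, \<tau>) \<in> trivs E" "x \<in> U" using triv_exists .
      then show "\<exists>V. open V \<and> x \<in> V \<and> smooth_in (base E) V (\<lambda>x. \<omega> x (map (\<lambda>X. X x) Xs))"
        using smooth_form_triv[OF \<omega>(1), of U \<tau> "[]"] triv_open 2 by auto
    qed
  next
    case 3
    then show ?thesis
      using smooth_form_eval \<omega>(1) Xs by simp
  qed
qed

lemma smooth_form_contraction:
  assumes \<omega>: "smooth_form E 1 \<omega>" and X: "smooth_section E X"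
  shows "smooth_form E 0 (contraction X \<omega>)"
proof -
  have "contraction X \<omega> x es = 0" if "es \<noteq> []" for x es
    unfolding contraction_def using that by (intro smooth_form_zero[OF \<omega>]) auto
  moreover from this have "contraction X \<omega> x es = 0" if "\<not> distinct es" for x es
    using that by (cases es) auto
  moreover have "smooth_in (base E) U (\<lambda>x. contraction X \<omega> x [])" for U
    using smooth_in_subset[OF smooth_form_eval[OF \<omega> X]] by (simp add: contraction_def)
  ultimately show ?thesis
    unfolding smooth_form_def by auto
qed

lemma smooth_form_diff:
  assumes F: "smooth_form E 0 F" and G: "smooth_form E 0 G"
  shows "smooth_form E 0 (\<lambda>x es. F x es - G x es)"
proof -
  have "F x es - G x es = 0" if "es \<noteq> []" for x es
    using that smooth_form_zero[OF F, of es x] smooth_form_zero[OF G, of es x] by simp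
  moreover from this have "F x es - G x es = 0" if "\<not> distinct es" for x es
    using that by (cases es) auto
  moreover have "smooth_in (base E) U (\<lambda>x. F x [] - G x [])" for U
  proof -
    have "smooth_fun (base E) (\<lambda>x. F x [] + (- 1) * G x [])"
      using smooth_form_eval_list[OF F, of "[]"] smooth_form_eval_list[OF G, of "[]"]
      by (intro smooth_in_add smooth_in_mult smooth_in_const mfd open_UNIV) auto
    then show ?thesis
      using smooth_in_subset by fastforce
  qed
  ultimately show ?thesis
    unfolding smooth_form_def by auto
qed

text \<open>In each summand the entry outside the fibre is either the argument of \<Phi> or remains
  among the arguments of \<omega>, and both vanish there. This matches the default value 0 of
  \<open>ext_d\<close>.\<close>

lemma wedge1_outside_fibre:
  assumes \<Phi>: "smooth_form E 1 \<Phi>" and \<omega>: "smooth_form E k \<omega>" and es: "\<not> set es \<subseteq> fibre E x"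
  shows "wedge1 \<Phi> \<omega> x es = 0"
proof -
  obtain j where j: "j < length es" "es ! j \<notin> fibre E x"
    using es by (metis in_set_conv_nth subsetI)
  have "\<Phi> x [es ! i] * \<omega> x (nths es (- {i})) = 0" if "i < length es" for i
  proof (cases "i = j")
    case True
    then show ?thesis
      using smooth_form_zero[OF \<Phi>, of "[es ! i]" x] j by simp
  next
    case False
    then have "es ! j \<in> set (nths es (- {i}))"
      using j by (auto simp: set_nths)
    then show ?thesis
      using smooth_form_zero[OF \<omega>, of "nths es (- {i})" x] j by auto
  qed
  then show ?thesis
    unfolding wedge1_def by (intro sum.neutral) (auto simp: mult.assoc)
qed

end


section \<open>The Koszul formula on Lie algebroids\<close>

locale smooth_algebroid =
  fixes L :: "('m::{t2_space, second_countable_topology}, 'b::real_inner, 'e, 'f::real_inner) algebroid"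
  assumes la: "lie_algebroid L"
begin

sublocale smooth_bundle L
  by unfold_locales (use la in \<open>simp add: lie_algebroid_def\<close>)

lemma anchor_tangent: "a \<in> fibre L x \<Longrightarrow> anchor L a \<in> tangent_space (base L) x"
  using la unfolding lie_algebroid_def by (elim conjE) blast

lemma anchor_fadd:
  "a \<in> fibre L x \<Longrightarrow> b \<in> fibre L x \<Longrightarrow> anchor L (fadd L a b) f = anchor L a f + anchor L b f"
  using la unfolding lie_algebroid_def by (elim conjE) blast

lemma anchor_fscale: "a \<in> fibre L x \<Longrightarrow> anchor L (fscale L c a) f = c * anchor L a f"
  using la unfolding lie_algebroid_def by (elim conjE) blast

lemma smooth_bracket:
  "smooth_section L X \<Longrightarrow> smooth_section L Y \<Longrightarrow> smooth_section L (bracket L X Y)"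
  using la unfolding lie_algebroid_def by (elim conjE) blast

lemma bracket_sadd:
  assumes "smooth_section L X" "smooth_section L Y" "smooth_section L Z"
  shows "bracket L X (sadd L Y Z) = sadd L (bracket L X Y) (bracket L X Z)"
proof -
  have "\<forall>X Y Z. smooth_section L X \<longrightarrow> smooth_section L Y \<longrightarrow> smooth_section L Z \<longrightarrow>
      bracket L X (sadd L Y Z) = sadd L (bracket L X Y) (bracket L X Z)"
    using la unfolding lie_algebroid_def by (elim conjE)
  then show ?thesis using assms by blast
qed

lemma bracket_anti:
  assumes "smooth_section L X" "smooth_section L Y"
  shows "bracket L X Y = sscale L (\<lambda>_. - 1) (bracket L Y X)"
proof -
  have "\<forall>X Y. smooth_section L X \<longrightarrow> smooth_section L Y \<longrightarrow>
      bracket L X Y = sscale L (\<lambda>_. - 1) (bracket L Y X)"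
    using la unfolding lie_algebroid_def by (elim conjE)
  then show ?thesis using assms by blast
qed

lemma bracket_sscale:
  assumes "smooth_section L X" "smooth_section L Y" "smooth_fun (base L) f"
  shows "bracket L X (sscale L f Y) =
    sadd L (sscale L f (bracket L X Y)) (sscale L (\<lambda>x. anchor L (X x) f) Y)"
proof -
  have "\<forall>X Y f. smooth_section L X \<longrightarrow> smooth_section L Y \<longrightarrow> smooth_fun (base L) f \<longrightarrow>
      bracket L X (sscale L f Y) =
        sadd L (sscale L f (bracket L X Y)) (sscale L (\<lambda>x. anchor L (X x) f) Y)"
    using la unfolding lie_algebroid_def by (elim conjE)
  then show ?thesis using assms by blast
qed

section \<open>The anchor as a derivation\<close>

lemma anchor_add:
  assumes "a \<in> fibre L x" "smooth_fun (base L) f" "smooth_fun (base L) g"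
  shows "anchor L a (\<lambda>y. f y + g y) = anchor L a f + anchor L a g"
  using anchor_tangent[OF assms(1)] assms(2,3) unfolding tangent_space_def by blast

lemma anchor_scale:
  assumes "a \<in> fibre L x" "smooth_fun (base L) f"
  shows "anchor L a (\<lambda>y. c * f y) = c * anchor L a f"
  using anchor_tangent[OF assms(1)] assms(2) unfolding tangent_space_def by blast

lemma anchor_mult:
  assumes "a \<in> fibre L x" "smooth_fun (base L) f" "smooth_fun (base L) g"
  shows "anchor L a (\<lambda>y. f y * g y) = f x * anchor L a g + g x * anchor L a f"
  using anchor_tangent[OF assms(1)] assms(2,3) unfolding tangent_space_def by blast

lemma anchor_zero: "a \<in> fibre L x \<Longrightarrow> anchor L a (\<lambda>y. 0) = 0"
  using anchor_scale[of a x "\<lambda>_. 0" 0] smooth_in_const[OF mfd open_UNIV, of "0 :: real"] by simp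

section \<open>Koszul sums of functions and 1-forms\<close>

lemma koszul_single: "koszul L \<omega> [X] x = anchor L (X x) (\<lambda>y. \<omega> y [])"
  by (simp add: koszul_def nths_Cons)

lemma koszul_pair:
  "koszul L \<omega> [X, Y] x = anchor L (X x) (\<lambda>y. \<omega> y [Y y]) - anchor L (Y x) (\<lambda>y. \<omega> y [X y])
    - \<omega> x [bracket L X Y x]"
  by (simp add: koszul_def nths_Cons lessThan_Suc)

text \<open>Deleting one section, or replacing two by their bracket, leaves
  \<open>length Xs - 1\<close> arguments, so every summand meets the default value of \<omega>. This
  settles \<open>ext_d\<close> on lists of unexpected length.\<close>

lemma koszul_wrong_length:
  assumes \<omega>: "smooth_form L k \<omega>" and Xs: "\<forall>X\<in>set Xs. smooth_section L X" "length Xs \<noteq> Suc k"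
  shows "koszul L \<omega> Xs x = 0"
proof -
  have 1: "anchor L ((Xs ! i) x) (\<lambda>y. \<omega> y (map (\<lambda>X. X y) (nths Xs (- {i})))) = 0"
    if "i < length Xs" for i
  proof -
    have "{j. j < length Xs \<and> j \<in> - {i}} = {..<length Xs} - {i}" by auto
    then have "length (nths Xs (- {i})) = length Xs - 1"
      using that by (simp add: length_nths)
    then have "\<omega> y (map (\<lambda>X. X y) (nths Xs (- {i}))) = 0" for y
      using Xs(2) that by (intro smooth_form_zero[OF \<omega>]) auto
    moreover have "(Xs ! i) x \<in> fibre L x"
      using Xs(1) that by (simp add: smooth_section_fibre)
    ultimately show ?thesis
      by (simp add: anchor_zero)
  qed
  have 2: "\<omega> x (bracket L (Xs ! i) (Xs ! j) x # map (\<lambda>X. X x) (nths Xs (- {i, j}))) = 0"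
    if "i < j" "j < length Xs" for i j
  proof -
    have "{l. l < length Xs \<and> l \<in> - {i, j}} = {..<length Xs} - {i, j}" by auto
    then have "length (nths Xs (- {i, j})) = length Xs - 2"
      using that by (simp add: length_nths)
    then show ?thesis
      using Xs(2) that by (intro smooth_form_zero[OF \<omega>]) auto
  qed
  show ?thesis
    unfolding koszul_def using 1 2 by (simp add: sum.neutral)
qed

lemma koszul_anti:
  assumes \<omega>: "smooth_form L 1 \<omega>" and X: "smooth_section L X" and Y: "smooth_section L Y"
  shows "koszul L \<omega> [X, Y] x = - koszul L \<omega> [Y, X] x"
proof -
  have "\<omega> x [bracket L X Y x] = - \<omega> x [bracket L Y X x]"
    using form_scale[OF \<omega> smooth_section_fibre[OF smooth_bracket[OF Y X]], where c = "- 1" and x = x]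
    by (simp add: bracket_anti[OF X Y] sscale_def)
  then show ?thesis by (simp add: koszul_pair)
qed

lemma koszul_add_right:
  assumes \<omega>: "smooth_form L 1 \<omega>"
    and X: "smooth_section L X" and Y: "smooth_section L Y" and Z: "smooth_section L Z"
  shows "koszul L \<omega> [X, sadd L Y Z] x = koszul L \<omega> [X, Y] x + koszul L \<omega> [X, Z] x"
proof -
  note fib = smooth_section_fibre[OF X] smooth_section_fibre[OF Y] smooth_section_fibre[OF Z]
    smooth_section_fibre[OF smooth_bracket[OF X Y]] smooth_section_fibre[OF smooth_bracket[OF X Z]]
  have "(\<lambda>y. \<omega> y [sadd L Y Z y]) = (\<lambda>y. \<omega> y [Y y] + \<omega> y [Z y])"
    by (simp add: sadd_def form_add[OF \<omega>] fib)
  then have "anchor L (X x) (\<lambda>y. \<omega> y [sadd L Y Z y]) =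
      anchor L (X x) (\<lambda>y. \<omega> y [Y y]) + anchor L (X x) (\<lambda>y. \<omega> y [Z y])"
    using anchor_add[OF fib(1) smooth_form_eval[OF \<omega> Y] smooth_form_eval[OF \<omega> Z]] by simp
  moreover have "anchor L (sadd L Y Z x) f = anchor L (Y x) f + anchor L (Z x) f" for f
    unfolding sadd_def by (rule anchor_fadd[OF fib(2,3)])
  moreover have "\<omega> x [bracket L X (sadd L Y Z) x] =
      \<omega> x [bracket L X Y x] + \<omega> x [bracket L X Z x]"
    unfolding bracket_sadd[OF X Y Z] by (simp add: sadd_def form_add[OF \<omega> fib(4,5)])
  ultimately show ?thesis
    by (simp add: koszul_pair)
qed

text \<open>The Leibniz rules of anchor and bracket each produce the product of \<rho>(X) f and
  \<omega>(Y). The two occur with opposite signs and cancel, which leaves f as an undifferentiated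
  factor.\<close>

lemma koszul_scale_right:
  assumes \<omega>: "smooth_form L 1 \<omega>"
    and X: "smooth_section L X" and Y: "smooth_section L Y" and f: "smooth_fun (base L) f"
  shows "koszul L \<omega> [X, sscale L f Y] x = f x * koszul L \<omega> [X, Y] x"
proof -
  note fib = smooth_section_fibre[OF X] smooth_section_fibre[OF Y]
    smooth_section_fibre[OF smooth_bracket[OF X Y]]
  have "(\<lambda>y. \<omega> y [sscale L f Y y]) = (\<lambda>y. f y * \<omega> y [Y y])"
    by (simp add: sscale_def form_scale[OF \<omega>] fib)
  then have "anchor L (X x) (\<lambda>y. \<omega> y [sscale L f Y y]) =
      f x * anchor L (X x) (\<lambda>y. \<omega> y [Y y]) + \<omega> x [Y x] * anchor L (X x) f"
    using anchor_mult[OF fib(1) f smooth_form_eval[OF \<omega> Y]] by simp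
  moreover have "anchor L (sscale L f Y x) g = f x * anchor L (Y x) g" for g
    unfolding sscale_def by (rule anchor_fscale[OF fib(2)])
  moreover have "\<omega> x [bracket L X (sscale L f Y) x] =
      f x * \<omega> x [bracket L X Y x] + anchor L (X x) f * \<omega> x [Y x]"
    unfolding bracket_sscale[OF X Y f]
    by (simp add: sadd_def sscale_def form_add[OF \<omega>, where x = x] form_scale[OF \<omega>, where x = x]
        fscale_fibre fib)
  ultimately show ?thesis
    by (simp add: koszul_pair algebra_simps)
qed

text \<open>For functions the formula involves X only through X x. For 1-forms, tensoriality
  replaces the second section, and antisymmetry moves the first section into the second slot so that
  it can be replaced as well.\<close>

lemma koszul_pointwise:
  assumes \<omega>: "smooth_form L k \<omega>" "k \<le> 1"
    and Xs: "\<forall>X\<in>set Xs. smooth_section L X" and Ys: "\<forall>X\<in>set Ys. smooth_section L X"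
    and eq: "map (\<lambda>X. X x) Xs = map (\<lambda>X. X x) Ys"
  shows "koszul L \<omega> Xs x = koszul L \<omega> Ys x"
proof -
  have len: "length Xs = length Ys"
    using eq by (rule map_eq_imp_length_eq)
  have right: "koszul L \<omega> [X, Y] x = koszul L \<omega> [X, Z] x"
    if "k = 1" "smooth_section L X" "smooth_section L Y" "smooth_section L Z" "Y x = Z x" for X Y Z
    using section_functional_pointwise[of "\<lambda>Y. koszul L \<omega> [X, Y] x" x Y Z] \<omega>(1) that
    by (simp add: koszul_add_right koszul_scale_right)
  consider "length Xs \<noteq> Suc k" | X Y where "k = 0" "Xs = [X]" "Ys = [Y]"
    | X X' Y Y' where "k = 1" "Xs = [X, X']" "Ys = [Y, Y']"
    using \<omega>(2) len
    by (cases Xs; cases Ys; cases "tl Xs"; cases "tl Ys"; cases "tl (tl Ys)"; cases k) auto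
  then show ?thesis
  proof cases
    case 1
    then show ?thesis
      using koszul_wrong_length[OF \<omega>(1)] Xs Ys len by simp
  next
    case 2
    then show ?thesis
      using eq by (simp add: koszul_single)
  next
    case 3
    have "koszul L \<omega> [X, X'] x = koszul L \<omega> [X, Y'] x"
      using 3 Xs Ys eq by (intro right) auto
    also have "\<dots> = - koszul L \<omega> [Y', X] x"
      using 3 Xs Ys \<omega>(1) by (intro koszul_anti) auto
    also have "\<dots> = - koszul L \<omega> [Y', Y] x"
      using 3 Xs Ys eq right[of Y' X Y] by simp
    also have "\<dots> = koszul L \<omega> [Y, Y'] x"
      using 3 Ys \<omega>(1) koszul_anti[of \<omega> Y Y'] by simp
    finally show ?thesis
      using 3 by simp
  qed
qed

text \<open>The list \<open>Xs\<close> is itself an admissible choice in the description defining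
  \<open>ext_d\<close>, which gives uniqueness; \<open>koszul_pointwise\<close> gives
  existence.\<close>

lemma ext_d_eval:
  assumes \<omega>: "smooth_form L k \<omega>" "k \<le> 1" and Xs: "\<forall>X\<in>set Xs. smooth_section L X"
  shows "ext_d L \<omega> x (map (\<lambda>X. X x) Xs) = koszul L \<omega> Xs x"
proof -
  have "set (map (\<lambda>X. X x) Xs) \<subseteq> fibre L x"
    using Xs smooth_section_fibre by auto
  moreover have "(THE r. \<forall>Ys. (\<forall>X\<in>set Ys. smooth_section L X) \<longrightarrow>
      map (\<lambda>X. X x) Ys = map (\<lambda>X. X x) Xs \<longrightarrow> koszul L \<omega> Ys x = r) = koszul L \<omega> Xs x"
    using Xs koszul_pointwise[OF \<omega>] by (intro the_equality) blast+
  ultimately show ?thesis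
    by (simp only: ext_d_def if_True)
qed

end


section \<open>The extended Lie algebroid\<close>

lemma inv_into_product_chart:
  assumes "inj_on \<phi> U" "x \<in> U"
  shows "inv_into (U \<times> UNIV) (\<lambda>(x, t). (\<phi> x, t)) (\<phi> x, t) = (x, t :: real)"
proof -
  have "inj_on (\<lambda>(x, t). (\<phi> x, t :: real)) (U \<times> UNIV)"
    using assms(1) by (auto simp: inj_on_def)
  from inv_into_f_f[OF this, of "(x, t)"] show ?thesis
    using assms(2) by simp
qed

text \<open>All trivializations of the pulled-back bundle live over cylinders, so these are the only
  open sets that have to be tested. The product charts leave the time coordinate unchanged.\<close>

lemma smooth_in_product_atlasI:
  assumes A: "smooth_manifold A" and "open W"
    and chart: "\<And>U \<phi>. (U, \<phi>) \<in> A \<Longrightarrow>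
      smooth_on (\<phi> ` (U \<inter> W) \<times> UNIV) (\<lambda>z. f (inv_into U \<phi> (fst z), snd z))"
  shows "smooth_in (product_atlas A) (W \<times> UNIV) f"
proof (rule smooth_inI)
  fix U' \<phi>' assume "(U', \<phi>') \<in> product_atlas A"
  then obtain U \<phi> where c: "(U, \<phi>) \<in> A" and eq: "U' = U \<times> UNIV" "\<phi>' = (\<lambda>(x, t). (\<phi> x, t))"
    by (auto simp: product_atlas_def)
  note chartD = manifold_chartD[OF A c]
  have inj: "inj_on \<phi> U"
    using chartD(4) by (rule inj_on_inverseI)
  have im: "\<phi>' ` (U' \<inter> W \<times> UNIV) = \<phi> ` (U \<inter> W) \<times> UNIV"
    by (force simp: eq)
  have "open (\<phi> ` (U \<inter> W) \<times> (UNIV :: real set))"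
    by (intro open_Times chartD(5) assms(2) open_UNIV)
  then have "smooth_on (\<phi> ` (U \<inter> W) \<times> UNIV) (\<lambda>z. f (inv_into U' \<phi>' z))"
    by (rule smooth_on_cong[THEN iffD2, OF _ _ chart[OF c]])
      (use chartD(4) inv_into_product_chart[OF inj] in \<open>auto simp: eq\<close>)
  then show "smooth_on (\<phi>' ` (U' \<inter> W \<times> UNIV)) (\<lambda>z. f (inv_into U' \<phi>' z))"
    unfolding im .
qed

lemma smooth_in_product_atlas_fst:
  assumes A: "smooth_manifold A" and W: "open W" and g: "smooth_in A W g"
  shows "smooth_in (product_atlas A) (W \<times> UNIV) (\<lambda>z. g (fst z))"
proof (rule smooth_in_product_atlasI[OF A W])
  fix U \<phi> assume c: "(U, \<phi>) \<in> A"
  from smooth_on_fst[OF manifold_chartD(5)[OF A c W] smooth_inD[OF g c]]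
  show "smooth_on (\<phi> ` (U \<inter> W) \<times> UNIV) (\<lambda>z. g (fst (inv_into U \<phi> (fst z), snd z)))"
    by simp
qed

lemma smooth_in_product_atlas_snd:
  assumes A: "smooth_manifold A" and W: "open W"
  shows "smooth_in (product_atlas A) (W \<times> UNIV) snd"
proof (rule smooth_in_product_atlasI[OF A W])
  fix U \<phi> assume c: "(U, \<phi>) \<in> A"
  show "smooth_on (\<phi> ` (U \<inter> W) \<times> UNIV) (\<lambda>z. snd (inv_into U \<phi> (fst z), snd z))"
    using manifold_chartD(5)[OF A c W]
    by (simp add: smooth_on_def C_k_on_linear open_Times bounded_linear_snd)
qed

text \<open>The form component of \<open>U_map\<close>, isolated so that it can be followed through
  contraction and d, which change the degree.\<close>

definition exp_lift :: "('m, 'e) form \<Rightarrow> ('m \<times> real, 'e \<times> real) form" where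
  "exp_lift \<omega> = (\<lambda>(x, t) es. exp t * lift_form \<omega> (x, t) es)"

lemma exp_lift_apply:
  "exp_lift \<omega> (x, t) es = (if \<forall>e\<in>set es. snd e = t then exp t * \<omega> x (map fst es) else 0)"
  by (simp add: exp_lift_def lift_form_def)

lemma contraction_exp_lift:
  "contraction (lift_section X) (exp_lift \<omega>) = exp_lift (contraction X \<omega>)"
  by (auto simp: fun_eq_iff contraction_def exp_lift_apply lift_section_def)

lemma exp_lift_diff:
  "exp_lift (\<lambda>x es. F x es - G x es) = (\<lambda>z es. exp_lift F z es - exp_lift G z es)"
  by (auto simp: fun_eq_iff exp_lift_apply algebra_simps)

locale algebroid_extension =
  fixes L :: "('m::{t2_space, second_countable_topology}, 'b::real_inner, 'e, 'f::real_inner) algebroid"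
    and \<Phi> :: "('m, 'e) form"
    and Lh :: "('m \<times> real, 'b \<times> real, 'e \<times> real, 'f) algebroid"
  assumes la: "lie_algebroid L" and cocycle: "smooth_form L 1 \<Phi>"
    and extension: "extended_lie_algebroid L \<Phi> Lh"
begin

sublocale L: smooth_algebroid L
  by unfold_locales (rule la)

text \<open>That M x R is a manifold and the pullback a vector bundle is part of the hypothesis that
  \<open>Lh\<close> is a Lie algebroid, so the whole theory above applies to it directly.\<close>

sublocale Lh: smooth_algebroid Lh
  by unfold_locales (use extension in \<open>simp add: extended_lie_algebroid_def\<close>)

lemma truncate_Lh: "vbundle.truncate Lh = pullback_bundle L"
  using extension by (simp add: extended_lie_algebroid_def)

section \<open>The pulled-back bundle and its time-independent sections\<close>

lemma base_Lh: "base Lh = product_atlas (base L)"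
  and proj_Lh: "proj Lh = (\<lambda>(e, t). (proj L e, t))"
  and fadd_Lh: "fadd Lh = (\<lambda>(a, t) (b, s). (fadd L a b, t))"
  and fscale_Lh: "fscale Lh = (\<lambda>c (a, t). (fscale L c a, t))"
  and trivs_Lh: "trivs Lh = (\<lambda>(U, \<tau>). (U \<times> UNIV, \<lambda>(e, t). \<tau> e)) ` trivs L"
  using truncate_Lh by (simp_all add: vbundle.truncate_def pullback_bundle_def)

lemma fibre_Lh: "e \<in> fibre Lh (x, t) \<longleftrightarrow> fst e \<in> fibre L x \<and> snd e = t"
  by (auto simp: fibre_def proj_Lh split: prod.splits)

lemma subset_fibre_Lh:
  "set es \<subseteq> fibre Lh (x, t) \<longleftrightarrow> set (map fst es) \<subseteq> fibre L x \<and> (\<forall>e\<in>set es. snd e = t)"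
  by (auto simp: subset_iff fibre_Lh)

lemma bracket_lift:
  "smooth_section L X \<Longrightarrow> smooth_section L Y \<Longrightarrow>
    bracket Lh (lift_section X) (lift_section Y) = lift_section (bracket L X Y)"
  using extension by (simp add: extended_lie_algebroid_def)

lemma anchor_lift:
  "smooth_section L X \<Longrightarrow> smooth_fun (base Lh) f \<Longrightarrow> anchor Lh (lift_section X (x, t)) f =
    anchor L (X x) (\<lambda>y. f (y, t)) + \<Phi> x [X x] * deriv (\<lambda>s. f (x, s)) t"
  using extension by (simp add: extended_lie_algebroid_def)

lemma trivs_LhE:
  assumes "(V, \<sigma>) \<in> trivs Lh"
  obtains U \<tau> where "(U, \<tau>) \<in> trivs L" "V = U \<times> UNIV" "\<sigma> = (\<lambda>(e, t). \<tau> e)"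
  using assms by (auto simp: trivs_Lh)

lemma smooth_lift_section:
  assumes X: "smooth_section L X"
  shows "smooth_section Lh (lift_section X)"
proof (rule Lh.smooth_sectionI)
  show "lift_section X z \<in> fibre Lh z" for z
    using L.smooth_section_fibre[OF X] by (cases z) (simp add: fibre_Lh lift_section_def)
next
  fix V \<sigma> assume "(V, \<sigma>) \<in> trivs Lh"
  then obtain U \<tau> where t: "(U, \<tau>) \<in> trivs L" "V = U \<times> UNIV" "\<sigma> = (\<lambda>(e, t). \<tau> e)"
    by (rule trivs_LhE)
  from smooth_in_product_atlas_fst[OF L.mfd L.triv_open[OF t(1)] L.smooth_section_triv[OF X t(1)]]
  show "smooth_in (base Lh) V (\<lambda>z. \<sigma> (lift_section X z))"
    by (simp add: base_Lh t lift_section_def case_prod_beta)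
qed

lemma smooth_exp_mult:
  assumes W: "open W" and g: "smooth_in (base L) W g"
  shows "smooth_in (base Lh) (W \<times> UNIV) (\<lambda>z. exp (snd z) * g (fst z))"
proof -
  note snd = smooth_in_product_atlas_snd[OF L.mfd W, folded base_Lh]
  show ?thesis
    by (intro smooth_in_mult smooth_in_compose_real[OF _ _ smooth_on_exp snd] Lh.mfd open_Times W
        open_UNIV smooth_in_product_atlas_fst[OF L.mfd W g, folded base_Lh])
qed

text \<open>Over a cylinder the pulled-back trivialization inverts to the old inverse paired with
  the time. Locally the lifted form is thus the exponential of time multiplied by the old
  coefficients, and its algebraic properties hold fibre by fibre.\<close>

lemma smooth_exp_lift:
  assumes \<omega>: "smooth_form L k \<omega>"
  shows "smooth_form Lh k (exp_lift \<omega>)"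
proof -
  have smooth: "\<forall>(V, \<sigma>)\<in>trivs Lh. \<forall>vs. length vs = k \<longrightarrow>
      smooth_in (base Lh) V (\<lambda>z. exp_lift \<omega> z (map (inv_into (fibre Lh z) \<sigma>) vs))"
  proof clarify
    fix V \<sigma> and vs :: "'f list" assume s: "(V, \<sigma>) \<in> trivs Lh" and k: "k = length vs"
    obtain U \<tau> where t: "(U, \<tau>) \<in> trivs L" "V = U \<times> UNIV" "\<sigma> = (\<lambda>(e, t). \<tau> e)"
      using s by (rule trivs_LhE)
    \<comment> \<open>Both sides lie in the fibre over (x, r) and have the same image v under
      \<sigma>, which is injective there.\<close>
    have inv: "inv_into (fibre Lh (x, r)) \<sigma> v = (inv_into (fibre L x) \<tau> v, r)" if "x \<in> U" for x r v
    proof (rule Lh.triv_eqI[OF s])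
      show V: "(x, r) \<in> V"
        using that by (simp add: t(2))
      show "inv_into (fibre Lh (x, r)) \<sigma> v \<in> fibre Lh (x, r)"
        by (rule Lh.triv_inv_fibre[OF s V])
      show "(inv_into (fibre L x) \<tau> v, r) \<in> fibre Lh (x, r)"
        by (simp add: fibre_Lh L.triv_inv_fibre[OF t(1) that])
      have "\<sigma> (inv_into (fibre L x) \<tau> v, r) = v"
        by (simp add: t(3) L.triv_inv[OF t(1) that])
      then show "\<sigma> (inv_into (fibre Lh (x, r)) \<sigma> v) = \<sigma> (inv_into (fibre L x) \<tau> v, r)"
        using Lh.triv_inv[OF s V] by simp
    qed
    have eq: "exp_lift \<omega> z (map (inv_into (fibre Lh z) \<sigma>) vs) =
        exp (snd z) * \<omega> (fst z) (map (inv_into (fibre L (fst z)) \<tau>) vs)" if "z \<in> V" for z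
      using that by (cases z) (auto simp: exp_lift_apply inv t(2) comp_def)
    show "smooth_in (base Lh) V (\<lambda>z. exp_lift \<omega> z (map (inv_into (fibre Lh z) \<sigma>) vs))"
    proof (rule smooth_in_cong[OF Lh.mfd Lh.triv_open[OF s] eq, THEN iffD2])
      show "smooth_in (base Lh) V
          (\<lambda>z. exp (snd z) * \<omega> (fst z) (map (inv_into (fibre L (fst z)) \<tau>) vs))"
        unfolding t(2)
        by (rule smooth_exp_mult[OF L.triv_open[OF t(1)] L.smooth_form_triv[OF \<omega> t(1) k[symmetric]]])
    qed
  qed
  show ?thesis
    unfolding smooth_form_def
  proof (intro conjI allI impI ballI)
    fix z :: "'m \<times> real" and es :: "('e \<times> real) list"
    obtain x t where z: "z = (x, t)" by fastforce
    show "exp_lift \<omega> z es = 0" if "\<not> (length es = k \<and> set es \<subseteq> fibre Lh z)"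
      using that L.smooth_form_zero[OF \<omega>, of "map fst es" x]
      unfolding z subset_fibre_Lh by (auto simp: exp_lift_apply)
    show "exp_lift \<omega> z es = 0" if "\<not> distinct es"
    proof -
      have "\<omega> x (map fst es) = 0" if "\<forall>e\<in>set es. snd e = t"
      proof -
        have "inj_on fst (set es)"
          using that by (intro inj_onI) (metis prod.expand)
        then have "\<not> distinct (map fst es)"
          using \<open>\<not> distinct es\<close> by (simp add: distinct_map)
        then show ?thesis
          using \<omega> unfolding smooth_form_def by blast
      qed
      then show ?thesis
        by (simp add: z exp_lift_apply)
    qed
    fix i assume es: "length es = k" "set es \<subseteq> fibre Lh z" "i < k"
    then have es': "length (map fst es) = k" "set (map fst es) \<subseteq> fibre L x" "i < k"
      "\<And>e. e \<in> set es \<Longrightarrow> snd e = t"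
      unfolding z subset_fibre_Lh by auto
    have upd: "exp_lift \<omega> z (es[i := (a, t)]) = exp t * \<omega> x ((map fst es)[i := a])" for a
    proof -
      have "\<forall>e\<in>set (es[i := (a, t)]). snd e = t"
        using es'(4) set_update_subset_insert[of es i "(a, t)"] by fastforce
      then show ?thesis
        by (simp add: z exp_lift_apply map_update)
    qed
    have "\<forall>x es i. length es = k \<longrightarrow> set es \<subseteq> fibre L x \<longrightarrow> i < k \<longrightarrow>
        (\<forall>a\<in>fibre L x. \<forall>b\<in>fibre L x.
          \<omega> x (es[i := fadd L a b]) = \<omega> x (es[i := a]) + \<omega> x (es[i := b])) \<and>
        (\<forall>c. \<forall>a\<in>fibre L x. \<omega> x (es[i := fscale L c a]) = c * \<omega> x (es[i := a]))"
      using \<omega> unfolding smooth_form_def by (elim conjE)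
    from this[THEN spec, THEN spec, THEN spec, THEN mp, THEN mp, THEN mp, OF es'(1-3)]
    have lin: "(\<forall>a\<in>fibre L x. \<forall>b\<in>fibre L x. \<omega> x ((map fst es)[i := fadd L a b]) =
          \<omega> x ((map fst es)[i := a]) + \<omega> x ((map fst es)[i := b])) \<and>
        (\<forall>c. \<forall>a\<in>fibre L x. \<omega> x ((map fst es)[i := fscale L c a]) = c * \<omega> x ((map fst es)[i := a]))" .
    show "exp_lift \<omega> z (es[i := fadd Lh a b]) = exp_lift \<omega> z (es[i := a]) + exp_lift \<omega> z (es[i := b])"
      if "a \<in> fibre Lh z" "b \<in> fibre Lh z" for a b
    proof -
      have ab: "a = (fst a, t)" "b = (fst b, t)" "fst a \<in> fibre L x" "fst b \<in> fibre L x"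
        using that by (simp_all add: z fibre_Lh prod_eq_iff)
      have "fadd Lh a b = (fadd L (fst a) (fst b), t)"
        by (subst ab(1), subst ab(2)) (simp add: fadd_Lh)
      moreover have "\<omega> x ((map fst es)[i := fadd L (fst a) (fst b)]) =
          \<omega> x ((map fst es)[i := fst a]) + \<omega> x ((map fst es)[i := fst b])"
        using lin ab(3,4) by blast
      ultimately show ?thesis
        using upd[of "fst a"] upd[of "fst b"] upd[of "fadd L (fst a) (fst b)"]
        by (simp add: ab(1,2)[symmetric] algebra_simps)
    qed
    show "exp_lift \<omega> z (es[i := fscale Lh c a]) = c * exp_lift \<omega> z (es[i := a])"
      if "a \<in> fibre Lh z" for a c
    proof -
      have a: "a = (fst a, t)" "fst a \<in> fibre L x"
        using that by (simp_all add: z fibre_Lh prod_eq_iff)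
      have "fscale Lh c a = (fscale L c (fst a), t)"
        by (subst a(1)) (simp add: fscale_Lh)
      moreover have "\<omega> x ((map fst es)[i := fscale L c (fst a)]) = c * \<omega> x ((map fst es)[i := fst a])"
        using lin a(2) by blast
      ultimately show ?thesis
        using upd[of "fst a"] upd[of "fscale L c (fst a)"] by (simp add: a(1)[symmetric])
    qed
  next
    show "case p of (V, \<sigma>) \<Rightarrow> \<forall>vs. length vs = k \<longrightarrow>
        smooth_in (base Lh) V (\<lambda>z. exp_lift \<omega> z (map (inv_into (fibre Lh z) \<sigma>) vs))"
      if "p \<in> trivs Lh" for p
      using bspec[OF smooth that] .
  qed
qed

text \<open>Bracket terms just acquire the factor \<open>exp t\<close>, since lifts bracket to
  lifts. In an anchor term the extended anchor adds \<Phi>(X) times a time derivative; with the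
  signs of the Koszul sum these additions assemble to the wedge product of \<Phi> and
  \<omega>.\<close>

lemma koszul_exp_lift:
  assumes \<omega>: "smooth_form L k \<omega>" "k \<le> 1" and Xs: "\<forall>X\<in>set Xs. smooth_section L X"
  shows "koszul Lh (exp_lift \<omega>) (map lift_section Xs) (x, t) =
    exp t * (koszul L \<omega> Xs x + wedge1 \<Phi> \<omega> x (map (\<lambda>X. X x) Xs))"
proof -
  have lift: "exp_lift \<omega> (y, s) (map (\<lambda>X. X (y, s)) (map lift_section Ys)) =
      exp s * \<omega> y (map (\<lambda>X. X y) Ys)" for y s Ys
    by (auto simp: exp_lift_apply lift_section_def comp_def)
  have anchor: "anchor Lh ((map lift_section Xs ! i) (x, t))
        (\<lambda>z. exp_lift \<omega> z (map (\<lambda>X. X z) (nths (map lift_section Xs) (- {i})))) =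
      exp t * (anchor L ((Xs ! i) x) (\<lambda>y. \<omega> y (map (\<lambda>X. X y) (nths Xs (- {i})))) +
        \<Phi> x [map (\<lambda>X. X x) Xs ! i] * \<omega> x (nths (map (\<lambda>X. X x) Xs) (- {i})))"
    if i: "i < length Xs" for i
  proof -
    define g where "g y = \<omega> y (map (\<lambda>X. X y) (nths Xs (- {i})))" for y
    have g: "smooth_fun (base L) g"
      unfolding g_def using Xs
      by (intro L.smooth_form_eval_list[OF \<omega>]) (auto dest: in_set_nthsD)
    have Xi: "smooth_section L (Xs ! i)"
      using Xs i by simp
    have "(\<lambda>z. exp_lift \<omega> z (map (\<lambda>X. X z) (nths (map lift_section Xs) (- {i})))) =
        (\<lambda>z. exp (snd z) * g (fst z))"
      using lift by (auto simp: fun_eq_iff g_def nths_map)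
    moreover have "smooth_fun (base Lh) (\<lambda>z. exp (snd z) * g (fst z))"
      using smooth_exp_mult[OF open_UNIV g] by simp
    \<comment> \<open>This is where the exponential matters: it is its own derivative, so the time
      direction returns the undifferentiated form.\<close>
    moreover have "deriv (\<lambda>s. exp s * g x) t = exp t * g x"
      by (intro DERIV_imp_deriv) (auto intro!: derivative_eq_intros)
    moreover have "anchor L ((Xs ! i) x) (\<lambda>y. exp t * g y) = exp t * anchor L ((Xs ! i) x) g"
      by (rule L.anchor_scale[OF L.smooth_section_fibre[OF Xi] g])
    ultimately show ?thesis
      using anchor_lift[OF Xi] i by (simp add: g_def[symmetric] nths_map algebra_simps)
  qed
  have bracket: "exp_lift \<omega> (x, t) (bracket Lh (map lift_section Xs ! i) (map lift_section Xs ! j) (x, t) #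
        map (\<lambda>X. X (x, t)) (nths (map lift_section Xs) (- {i, j}))) =
      exp t * \<omega> x (bracket L (Xs ! i) (Xs ! j) x # map (\<lambda>X. X x) (nths Xs (- {i, j})))"
    if "i < j" "j < length Xs" for i j
    using lift[of x t "bracket L (Xs ! i) (Xs ! j) # nths Xs (- {i, j})"] Xs that
    by (simp add: bracket_lift nths_map)
  have "koszul Lh (exp_lift \<omega>) (map lift_section Xs) (x, t) =
      (\<Sum>i<length Xs. (- 1) ^ i * (exp t *
        (anchor L ((Xs ! i) x) (\<lambda>y. \<omega> y (map (\<lambda>X. X y) (nths Xs (- {i})))) +
          \<Phi> x [map (\<lambda>X. X x) Xs ! i] * \<omega> x (nths (map (\<lambda>X. X x) Xs) (- {i}))))) +
      (\<Sum>j<length Xs. \<Sum>i<j. (- 1) ^ (i + j) * (exp t *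
        \<omega> x (bracket L (Xs ! i) (Xs ! j) x # map (\<lambda>X. X x) (nths Xs (- {i, j})))))"
    unfolding koszul_def length_map
    by (intro arg_cong2[of _ _ _ _ plus] sum.cong refl arg_cong2[of _ _ _ _ times] anchor bracket)
      auto
  then show ?thesis
    by (simp add: koszul_def wedge1_def sum_distrib_left sum.distrib algebra_simps)
qed

lemma ext_d_exp_lift:
  assumes \<omega>: "smooth_form L k \<omega>" "k \<le> 1"
  shows "ext_d Lh (exp_lift \<omega>) = exp_lift (ext_d_tw L \<Phi> \<omega>)"
proof (intro ext)
  fix z :: "'m \<times> real" and es :: "('e \<times> real) list"
  obtain x t where z: "z = (x, t)" by fastforce
  show "ext_d Lh (exp_lift \<omega>) z es = exp_lift (ext_d_tw L \<Phi> \<omega>) z es"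
  proof (cases "set es \<subseteq> fibre Lh z")
    case True
    then have "set (map fst es) \<subseteq> fibre L x" and snd: "\<forall>e\<in>set es. snd e = t"
      unfolding z subset_fibre_Lh by auto
    then obtain Xs where Xs: "\<forall>X\<in>set Xs. smooth_section L X" "map (\<lambda>X. X x) Xs = map fst es"
      using L.sections_through by metis
    \<comment> \<open>All elements carry the time t, so sections of \<open>L\<close> through their
      first components lift to time-independent sections through \<open>es\<close> itself.\<close>
    have "es = map (\<lambda>e. (e, t)) (map fst es)"
      using snd by (auto simp: comp_def intro!: map_idI[symmetric])
    also have "\<dots> = map (\<lambda>X. X z) (map lift_section Xs)"
      by (simp add: Xs(2)[symmetric] z lift_section_def comp_def)
    finally have "ext_d Lh (exp_lift \<omega>) z es = koszul Lh (exp_lift \<omega>) (map lift_section Xs) z"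
      using Lh.ext_d_eval[OF smooth_exp_lift[OF \<omega>(1)] \<omega>(2), of "map lift_section Xs" z] Xs(1)
      by (simp add: smooth_lift_section)
    also have "\<dots> = exp t * ext_d_tw L \<Phi> \<omega> x (map fst es)"
      using L.ext_d_eval[OF \<omega> Xs(1), of x]
      by (simp add: z koszul_exp_lift[OF \<omega> Xs(1)] ext_d_tw_def Xs(2))
    finally show ?thesis
      using snd by (simp add: z exp_lift_apply)
  next
    case False
    \<comment> \<open>Off the fibre the left-hand side is 0 by definition. If some time differs from
      t, \<open>exp_lift\<close> vanishes too; otherwise a first component leaves the fibre of
      \<open>L\<close>, and both parts of the twisted derivative take their default value.\<close>
    then have "ext_d_tw L \<Phi> \<omega> x (map fst es) = 0" if "\<forall>e\<in>set es. snd e = t"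
    proof -
      have "\<not> set (map fst es) \<subseteq> fibre L x"
        using False that unfolding z subset_fibre_Lh by blast
      then show ?thesis
        using L.wedge1_outside_fibre[OF cocycle \<omega>(1)]
        unfolding ext_d_tw_def ext_d_def by (simp only: if_False add_0_left)
    qed
    with False show ?thesis
      by (simp add: z exp_lift_apply ext_d_def)
  qed
qed

text \<open>In Cartan's formula d acts once on the 1-form and once on its contraction, a function;
  the intertwining of d is thus used with k = 1 and k = 0.\<close>

lemma lie_derivative_exp_lift:
  assumes "smooth_form L 1 \<omega>" "smooth_section L X"
  shows "lie_derivative Lh (lift_section X) (exp_lift \<omega>) = exp_lift (lie_derivative_tw L \<Phi> X \<omega>)"
  unfolding lie_derivative_def lie_derivative_tw_def contraction_exp_lift
    ext_d_exp_lift[OF assms(1) order_refl] ext_d_exp_lift[OF L.smooth_form_contraction[OF assms] le0[of 1]]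
  by (auto simp: fun_eq_iff exp_lift_apply algebra_simps)

end

theorem mainTheorem8:
  fixes L :: "('m::{t2_space, second_countable_topology}, 'b::real_inner, 'e, 'f::real_inner) algebroid"
    and Lh :: "('m \<times> real, 'b \<times> real, 'e \<times> real, 'f) algebroid"
    and \<Phi> \<xi> \<eta> :: "('m, 'e) form"
    and X Y :: "'m \<Rightarrow> 'e"
  assumes "lie_algebroid L"
    and "smooth_form L 1 \<Phi>"
    and "ext_d L \<Phi> = (\<lambda>x es. 0)"
    and "extended_lie_algebroid L \<Phi> Lh"
    and "smooth_section L X" and "smooth_section L Y"
    and "smooth_form L 1 \<xi>" and "smooth_form L 1 \<eta>"
  shows "courant_bracket Lh (U_map (X, \<xi>)) (U_map (Y, \<eta>)) =
    U_map (bracket L X Y,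
      \<lambda>x es. lie_derivative_tw L \<Phi> X \<eta> x es - lie_derivative_tw L \<Phi> Y \<xi> x es +
        1 / 2 * ext_d_tw L \<Phi> (\<lambda>y as. contraction Y \<xi> y as - contraction X \<eta> y as) x es)"
proof -
  interpret algebroid_extension L \<Phi> Lh
    by unfold_locales (use assms in auto)
  have U: "U_map (Z, \<omega>) = (lift_section Z, exp_lift \<omega>)" for Z :: "'m \<Rightarrow> 'e" and \<omega>
    by (simp add: exp_lift_def)
  have "smooth_form L 0 (\<lambda>y as. contraction Y \<xi> y as - contraction X \<eta> y as)"
    by (intro L.smooth_form_diff L.smooth_form_contraction assms)
  \<comment> \<open>The pairing term is a 0-form. After \<open>exp_lift_diff\<close> its lift
    appears as the difference of lifted contractions, the shape in which it occurs in the bracket of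
    \<open>Lh\<close>.\<close>
  note d = ext_d_exp_lift[OF this le0[of 1], unfolded exp_lift_diff]
  show ?thesis
    unfolding U courant_bracket.simps bracket_lift[OF assms(5,6)] contraction_exp_lift d
      lie_derivative_exp_lift[OF assms(8,5)] lie_derivative_exp_lift[OF assms(7,6)]
    by (auto simp: fun_eq_iff exp_lift_apply algebra_simps)
qed

end
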